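(* Let $f \in K[z]$ be a polynomial of degree $d \ge 2$. Then \[ \sum_{\substack{x \in \mathrm{Fix}(f) \\ x \text{ repelling}}} \deg_f(x) = d. \]
   Context: $K$ is an algebraically closed field that is complete with respect to a nontrivial nonarchimedean absolute value. $\mathbb{P}^{1,\mathrm{an}}_K$ is the Berkovich projective line over $K$, on which $f$ acts; its classical points are the type I points, identified with $\mathbb{P}^1(K)$. $\mathrm{Fix}(f) = \{x \in \mathbb{P}^{1,\mathrm{an}}_K : f(x) = x\}$. $\deg_f(x)$ denotes the local degree of $f$ at $x$ (the usual ramification index if $x$ is classical; for a type II fixed point, the degree of the induced rational function on the tangent directions at $x$). A classical fixed point is repelling if its multiplier $\lambda$ (i.e. $f'(x)$ in a coordinate where $x$ is finite) satisfies $|\lambda| > 1$; a nonclassical fixed point $x$ is repelling if $\deg_f(x) \ge 2$ (such a point is necessarily of type II). The sum runs over both classical and type II repelling fixed points. *)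

theory Defs
  imports
    "HOL-Analysis.Abstract_Metric_Spaces"
    "HOL-Computational_Algebra.Polynomial"
    "HOL-Algebra.UnivPoly"
    "HOL-Algebra.QuotRing"
begin

text \<open>
  Algebraic closedness of the ground field is supplied by the type class. Since HOL has no class for
  non-archimedean absolute values, the absolute value \<open>v\<close> is a parameter.
\<close>

locale complete_nonarch_field =
  fixes v :: "'a::alg_closed_field \<Rightarrow> real"
  assumes nonneg: "0 \<le> v x"
    and eq_zero_iff: "v x = 0 \<longleftrightarrow> x = 0"
    and mult: "v (x * y) = v x * v y"
    and ultrametric: "v (x + y) \<le> max (v x) (v y)"
    and nontrivial: "\<exists>x. x \<noteq> 0 \<and> v x \<noteq> 1"
    and complete: "Metric_space.mcomplete UNIV (\<lambda>x y. v (x - y))"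

definition valuation_ring :: "('a::field \<Rightarrow> real) \<Rightarrow> 'a ring" where
  "valuation_ring v =
     \<lparr>carrier = {x. v x \<le> 1}, mult = (*), one = 1, zero = 0, add = (+)\<rparr>"

definition maximal_ideal :: "('a::field \<Rightarrow> real) \<Rightarrow> 'a set" where
  "maximal_ideal v = {x. v x < 1}"

definition residue_field :: "('a::field \<Rightarrow> real) \<Rightarrow> 'a set ring" where
  "residue_field v = valuation_ring v Quot maximal_ideal v"

definition residue :: "('a::field \<Rightarrow> real) \<Rightarrow> 'a \<Rightarrow> 'a set" where
  "residue v x = maximal_ideal v +>\<^bsub>valuation_ring v\<^esub> x"


section \<open>The Berkovich projective line\<close>

text \<open>
  A point other than \<open>\<infinity>\<close> is a multiplicative seminorm on the polynomial ring extending \<open>v\<close>.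
\<close>

definition multiplicative_seminorm ::
    "('a::field \<Rightarrow> real) \<Rightarrow> ('a poly \<Rightarrow> real) \<Rightarrow> bool" where
  "multiplicative_seminorm v x \<longleftrightarrow>
     (\<forall>p. 0 \<le> x p) \<and> (\<forall>c. x [:c:] = v c) \<and>
     (\<forall>p q. x (p * q) = x p * x q) \<and> (\<forall>p q. x (p + q) \<le> x p + x q)"

datatype 's with_infinity = Infinity | Seminorm 's

type_synonym 'a berkovich_point = "('a poly \<Rightarrow> real) with_infinity"

definition berkovich_P1 :: "('a::field \<Rightarrow> real) \<Rightarrow> 'a berkovich_point set" where
  "berkovich_P1 v = insert Infinity (Seminorm ` {x. multiplicative_seminorm v x})"

definition evaluation_seminorm :: "('a::field \<Rightarrow> real) \<Rightarrow> 'a \<Rightarrow> 'a poly \<Rightarrow> real" where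
  "evaluation_seminorm v a p = v (poly p a)"

text \<open>
  The Gauss norm of the disc \<open>D(a, r)\<close>: if \<open>p = (\<Sum>i. c\<^sub>i (z - a)^i)\<close>, its value at \<open>p\<close> is
  the maximum of the \<open>v c\<^sub>i * r^i\<close>.
\<close>

definition disc_seminorm :: "('a::field \<Rightarrow> real) \<Rightarrow> 'a \<Rightarrow> real \<Rightarrow> 'a poly \<Rightarrow> real" where
  "disc_seminorm v a r p =
     Max ((\<lambda>i. v (Polynomial.coeff (pcompose p [:a, 1:]) i) * r ^ i) ` {..Polynomial.degree p})"

definition type_I :: "('a::field \<Rightarrow> real) \<Rightarrow> ('a poly \<Rightarrow> real) \<Rightarrow> bool" where
  "type_I v x \<longleftrightarrow> (\<exists>a. x = evaluation_seminorm v a)"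

definition type_II :: "('a::field \<Rightarrow> real) \<Rightarrow> ('a poly \<Rightarrow> real) \<Rightarrow> bool" where
  "type_II v x \<longleftrightarrow> (\<exists>a c. c \<noteq> 0 \<and> x = disc_seminorm v a (v c))"

definition pushforward :: "'a::field poly \<Rightarrow> ('a poly \<Rightarrow> real) \<Rightarrow> 'a poly \<Rightarrow> real" where
  "pushforward f x = (\<lambda>g. x (pcompose g f))"

text \<open>The action of a nonconstant polynomial.\<close>

fun act :: "'a::field poly \<Rightarrow> 'a berkovich_point \<Rightarrow> 'a berkovich_point" where
  "act f Infinity = Infinity"
| "act f (Seminorm x) = Seminorm (pushforward f x)"

definition Fix :: "('a::field \<Rightarrow> real) \<Rightarrow> 'a poly \<Rightarrow> 'a berkovich_point set" where
  "Fix v f = {\<xi> \<in> berkovich_P1 v. act f \<xi> = \<xi>}"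


section \<open>Tangent directions at a type II point\<close>

text \<open>
  In the coordinate \<open>w = (z - a) / c\<close> the point \<open>disc_seminorm v a (v c)\<close> is the Gauss point.
  The components of its complement are the open residue discs \<open>v (w - b) < 1\<close> with \<open>v b \<le> 1\<close>,
  indexed by the residue of \<open>b\<close>, and the component of \<open>\<infinity>\<close>. So the tangent directions
  form the projective line over the residue field, with \<open>None\<close> as the direction of \<open>\<infinity>\<close>.
  The function below gives the direction of any point other than the Gauss point itself.
\<close>

definition direction ::
    "('a::field \<Rightarrow> real) \<Rightarrow> 'a \<Rightarrow> 'a \<Rightarrow> 'a berkovich_point \<Rightarrow> 'a set option" where
  "direction v a c \<eta> =
     (case \<eta> of
        Infinity \<Rightarrow> None
      | Seminorm y \<Rightarrow>
          (if \<exists>b. v b \<le> 1 \<and> y [:- (a + c * b), 1:] < v c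
           then Some (residue v (SOME b. v b \<le> 1 \<and> y [:- (a + c * b), 1:] < v c))
           else None))"

text \<open>
  A polynomial sends the direction of \<open>\<infinity>\<close> at \<open>x\<close> to the direction of \<open>\<infinity>\<close> at the image of \<open>x\<close>,
  and each other direction, being an open disc, onto an open disc that is again a direction. So the
  rational function induced on directions is a polynomial \<open>p\<close> over the residue field, and it is
  determined by the residue discs. The pairs \<open>(a, c)\<close> and \<open>(b, e)\<close> are coordinates at \<open>x\<close> and
  at its image.
\<close>

definition induces_on_directions ::
    "('a::field \<Rightarrow> real) \<Rightarrow> 'a poly \<Rightarrow> 'a \<times> 'a \<Rightarrow> 'a \<times> 'a \<Rightarrow> (nat \<Rightarrow> 'a set) \<Rightarrow> bool" where
  "induces_on_directions v f = (\<lambda>(a, c) (b, e) p.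
     p \<in> carrier (UP (residue_field v)) \<and>
     (\<forall>\<eta> \<in> berkovich_P1 v. \<forall>u. direction v a c \<eta> = Some u \<longrightarrow>
        direction v b e (act f \<eta>) = Some (eval (residue_field v) (residue_field v) id u p)))"

text \<open>
  Changing the choice of coordinates composes the induced polynomial with affine bijections over the
  residue field, which does not affect its degree. The polynomial itself is unique because
  the residue field is infinite.
\<close>

definition coordinates :: "('a::field \<Rightarrow> real) \<Rightarrow> ('a poly \<Rightarrow> real) \<Rightarrow> 'a \<times> 'a" where
  "coordinates v x = (SOME (a, c). c \<noteq> 0 \<and> x = disc_seminorm v a (v c))"

definition type_II_degree ::
    "('a::field \<Rightarrow> real) \<Rightarrow> 'a poly \<Rightarrow> ('a poly \<Rightarrow> real) \<Rightarrow> nat" where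
  "type_II_degree v f x =
     deg (residue_field v)
       (THE p. induces_on_directions v f (coordinates v x) (coordinates v (pushforward f x)) p)"


section \<open>Local degrees, multipliers and repelling fixed points\<close>

text \<open>
  In the coordinate \<open>w = 1 / z\<close> at \<open>\<infinity>\<close> the map \<open>f\<close> of degree \<open>d\<close> is \<open>w^d / reflect_poly f w\<close>,
  whose denominator does not vanish at \<open>w = 0\<close>. This gives its ramification index and its
  derivative (by the quotient rule) at \<open>\<infinity>\<close>.

  At type III and type IV points, the local degree of a polynomial is the value which the local
  degree eventually takes along the type II points decreasing to the given one. As the local degree
  is nondecreasing in the direction of \<open>\<infinity>\<close>, this is the least local degree at a
  type II point above it (in the pointwise order on seminorms).
\<close>

fun local_degree :: "('a::field \<Rightarrow> real) \<Rightarrow> 'a poly \<Rightarrow> 'a berkovich_point \<Rightarrow> nat" where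
  "local_degree v f Infinity = Polynomial.order 0 (Polynomial.monom 1 (Polynomial.degree f) :: 'a poly)"
| "local_degree v f (Seminorm x) =
     (if type_I v x then
        (let a = (THE a. x = evaluation_seminorm v a) in Polynomial.order a (f - [:poly f a:]))
      else if type_II v x then type_II_degree v f x
      else (LEAST n. \<exists>y. type_II v y \<and> x \<le> y \<and> n = type_II_degree v f y))"

definition multiplier_at_infinity :: "'a::field poly \<Rightarrow> 'a" where
  "multiplier_at_infinity f =
     (let N = Polynomial.monom 1 (Polynomial.degree f); D = reflect_poly f
      in (poly (pderiv N) 0 * poly D 0 - poly N 0 * poly (pderiv D) 0) / (poly D 0)\<^sup>2)"

text \<open>Whether a fixed point is repelling; meaningful for points of \<open>Fix v f\<close> only.\<close>

fun repelling :: "('a::field \<Rightarrow> real) \<Rightarrow> 'a poly \<Rightarrow> 'a berkovich_point \<Rightarrow> bool" where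
  "repelling v f Infinity \<longleftrightarrow> v (multiplier_at_infinity f) > 1"
| "repelling v f (Seminorm x) \<longleftrightarrow>
     (if type_I v x then v (poly (pderiv f) (THE a. x = evaluation_seminorm v a)) > 1
      else local_degree v f (Seminorm x) \<ge> 2)"

end

theory Submission
  imports Defs
begin

text \<open>
  Let \<open>g = f - z\<close>, a polynomial of degree \<open>d\<close> whose zeros are the finite classical fixed points of
  \<open>f\<close>. The idea is that every zero of \<open>g\<close> lies below exactly one repelling fixed point of the
  Berkovich line, and that the number of zeros below a repelling fixed point, with multiplicity,
  is its local degree. Here a zero \<open>b\<close> lies below \<open>x\<close> if evaluation at \<open>b\<close> is bounded by the
  seminorm \<open>x\<close>: for a disc this means that \<open>b\<close> belongs to the disc. Summing over the \<open>d\<close> zeros of \<open>g\<close>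
  gives the formula.

  The tool is the Weierstrass degree of a polynomial on a disc \<open>D(a, r)\<close>: the last index \<open>i\<close> at which
  \<open>v c\<^sub>i * r^i\<close> is maximal, where the \<open>c\<^sub>i\<close> are the Taylor coefficients at \<open>a\<close>. Gauss's lemma says
  that it is additive under products, so it counts the zeros in the disc
  (\<open>weierstrass_degree_eq_number_of_roots\<close>). On the other hand, the local degree of \<open>f\<close> at a type II
  point is the Weierstrass degree of \<open>f - f a\<close>, since that is the degree of the reduction
  of \<open>f\<close> in suitable coordinates (\<open>type_II_degree_disc\<close>).

  Counting (\<open>local_degree_eq_number_of_fixed_points\<close>): on a fixed disc of radius \<open>r\<close> and degree
  \<open>n \<ge> 2\<close> the Gauss norm of \<open>f - f a\<close> is \<open>r\<close> and is attained last at \<open>n\<close>, and passing to \<open>g\<close> alters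
  the terms of degree at most \<open>1\<close> only, by at most \<open>r\<close>. So \<open>g\<close> has Weierstrass degree \<open>n\<close> there, too.
  At a classical repelling fixed point both numbers are \<open>1\<close>.

  Existence and uniqueness (\<open>repelling_fixed_above_fixed_point\<close>, \<open>repelling_fixed_unique\<close>): let \<open>b\<close> be
  a zero of \<open>g\<close> and let \<open>c\<^sub>i\<close> be the Taylor coefficients of \<open>f\<close> at \<open>b\<close>. If \<open>v c\<^sub>1 > 1\<close> then \<open>b\<close> is
  repelling, and the discs about \<open>b\<close> all grow under \<open>f\<close>. Suppose that \<open>v c\<^sub>1 \<le> 1\<close>. The image
  of \<open>D(b, r)\<close> is the disc about \<open>b\<close> whose radius is the largest \<open>v c\<^sub>i * r^i\<close> with \<open>i \<ge> 1\<close>. The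
  largest \<open>r\<close> for which this is at most \<open>r\<close> is the one that gives a repelling fixed point. Beyond it a
  term with \<open>i \<ge> 2\<close> makes the disc grow strictly, and below it such terms are too small to be dominant.

  The fixed points of types III and IV are not repelling
  (\<open>local_degree_fixed_not_type_I_II\<close>). If \<open>x\<close> is fixed then \<open>x g \<le> x (z - a)\<close> for every \<open>a\<close>. For a type
  IV point one may choose \<open>a\<close> so near to \<open>x\<close> that \<open>g\<close> has no zero in the corresponding disc; then
  the constant term of \<open>g\<close> dominates and \<open>f\<close> is a translation up to a small perturbation. For a
  type III point the radius \<open>r\<close> is not a value of \<open>v\<close>, so no \<open>v c\<^sub>i * r^i\<close> with \<open>i \<ge> 2\<close> can be equal to
  \<open>r\<close>. In both cases the linear term dominates, also on slightly larger discs whose radius is a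
  value, and there the local degree is \<open>1\<close>.
\<close>

section \<open>Ultrametric estimates\<close>

lemma ultrametric_sum_le:
  fixes N :: "'b::comm_monoid_add \<Rightarrow> real"
  assumes "\<And>p q. N (p + q) \<le> max (N p) (N q)" "N 0 \<le> B" "\<And>i. i \<in> A \<Longrightarrow> N (h i) \<le> B"
  shows "N (sum h A) \<le> B"
  using assms(3)
proof (induction A rule: infinite_finite_induct)
  case (insert i A)
  have "N (h i + sum h A) \<le> max (N (h i)) (N (sum h A))" by (rule assms(1))
  also have "\<dots> \<le> B" using insert by auto
  finally show ?case using insert by simp
qed (use assms(2) in auto)

lemma ultrametric_sum_less:
  fixes N :: "'b::comm_monoid_add \<Rightarrow> real"
  assumes "\<And>p q. N (p + q) \<le> max (N p) (N q)" "N 0 < B" "\<And>i. i \<in> A \<Longrightarrow> N (h i) < B"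
  shows "N (sum h A) < B"
  using assms(3)
proof (induction A rule: infinite_finite_induct)
  case (insert i A)
  have "N (h i + sum h A) \<le> max (N (h i)) (N (sum h A))" by (rule assms(1))
  also have "\<dots> < B" using insert by auto
  finally show ?case using insert by simp
qed (use assms(2) in auto)

context complete_nonarch_field
begin

lemma v_0 [simp]: "v 0 = 0"
  by (simp add: eq_zero_iff)

lemma v_eq_0 [simp]: "v x = 0 \<longleftrightarrow> x = 0"
  by (rule eq_zero_iff)

lemma v_pos_iff [simp]: "0 < v x \<longleftrightarrow> x \<noteq> 0"
  using nonneg[of x] eq_zero_iff[of x] by linarith

lemma v_1 [simp]: "v 1 = 1"
  using mult[of 1 1] eq_zero_iff[of 1] by simp

lemma v_minus [simp]: "v (- x) = v x"
proof -
  have "v (- 1) * v (- 1) = 1"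
    using mult[of "- 1" "- 1"] by simp
  hence "(v (- 1) - 1) * (v (- 1) + 1) = 0"
    by (simp add: algebra_simps)
  hence "v (- 1) = 1"
    using nonneg[of "- 1"] by auto
  thus ?thesis using mult[of "- 1" x] by simp
qed

lemma v_diff_le: "v (x - y) \<le> max (v x) (v y)"
  using ultrametric[of x "- y"] by simp

lemma v_minus_commute: "v (x - y) = v (y - x)"
  using v_minus[of "x - y"] by simp

lemma v_power [simp]: "v (x ^ n) = v x ^ n"
  by (induction n) (simp_all add: mult)

lemma v_inverse [simp]: "v (inverse x) = inverse (v x)"
proof (cases "x = 0")
  case False
  thus ?thesis using mult[of x "inverse x"] by (simp add: field_simps)
qed simp

lemma v_divide [simp]: "v (x / y) = v x / v y"
  by (simp add: divide_inverse mult)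

lemma v_add_eq_right: "v (x + y) = v y" if "v x < v y"
proof (rule antisym)
  show "v (x + y) \<le> v y" using ultrametric[of x y] that by simp
  have "v y \<le> max (v (x + y)) (v x)"
    using v_diff_le[of "x + y" x] by simp
  thus "v y \<le> v (x + y)" using that by linarith
qed

lemma v_of_nat_le_1: "v (of_nat n) \<le> 1"
proof (induction n)
  case (Suc n)
  thus ?case using ultrametric[of 1 "of_nat n"] by simp
qed simp

lemma v_sum_le: "v (sum h A) \<le> B" if "0 \<le> B" "\<And>i. i \<in> A \<Longrightarrow> v (h i) \<le> B"
  using that by (intro ultrametric_sum_le[of v] ultrametric) auto

lemma v_sum_less: "v (sum h A) < B" if "0 < B" "\<And>i. i \<in> A \<Longrightarrow> v (h i) < B"
  using that by (intro ultrametric_sum_less[of v] ultrametric) auto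

text \<open>
  The value group is divisible because nth roots exist, and it is not trivial; so it is dense in
  the positive reals.
\<close>

lemma value_group_dense:
  assumes "0 < r" "r < R"
  obtains c where "c \<noteq> 0" "r < v c" "v c < R"
proof -
  obtain t0 where t0: "t0 \<noteq> 0" "v t0 \<noteq> 1" using nontrivial by blast
  obtain t where t: "v t > 1"
  proof (cases "v t0 > 1")
    case False
    hence "v (inverse t0) > 1" using t0 by (simp add: one_less_inverse_iff)
    thus ?thesis using that by blast
  qed (use that in blast)
  have "1 < R / r" using assms by simp
  then obtain n where n: "v t < (R / r) ^ n" using real_arch_pow by blast
  have "n > 0" using n t by (cases n) auto
  then obtain u where u: "u ^ n = t" using nth_root_exists by blast
  have vu: "v u ^ n = v t" using u by (metis v_power)
  have u1: "1 < v u" using vu t by (metis linorder_not_less nonneg power_le_one)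
  have uR: "v u < R / r"
    using n vu \<open>1 < R / r\<close> by (metis power_less_imp_less_base less_eq_real_def less_trans zero_less_one)
  \<comment> \<open>The powers of \<open>u\<close> have ratios below \<open>R / r\<close>, so the first one above \<open>r\<close> is still below \<open>R\<close>.\<close>
  define k where "k = \<lfloor>log (v u) r\<rfloor> + 1"
  have k: "r < v u powi k" "v u powi (k - 1) \<le> r"
  proof -
    have "log (v u) r < of_int k" "of_int (k - 1) \<le> log (v u) r"
      unfolding k_def by linarith+
    hence "r < v u powr of_int k" "v u powr of_int (k - 1) \<le> r"
      using u1 assms(1) by (simp_all add: log_less_iff le_log_iff)
    moreover have "v u powr of_int m = v u powi m" for m
      using u1 by (intro powr_real_of_int') auto
    ultimately show "r < v u powi k" "v u powi (k - 1) \<le> r" by metis+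
  qed
  have vc: "v (u powi k) = v u powi k"
    by (simp add: power_int_def)
  have "v u powi k = v u * v u powi (k - 1)"
    using u1 power_int_add_1[of "v u" "k - 1"] by (cases "u = 0") (simp_all add: mult_ac)
  also have "\<dots> \<le> v u * r" using k(2) nonneg by (rule mult_left_mono)
  also have "\<dots> < R" using uR assms by (simp add: field_simps)
  finally have "v (u powi k) < R" using vc by simp
  moreover have "u powi k \<noteq> 0" using u1 by auto
  ultimately show ?thesis using that k(1) vc by metis
qed

end

section \<open>Weierstrass degrees\<close>

text \<open>
  The Weierstrass degree of a polynomial on the disc of radius \<open>r\<close> about \<open>0\<close> is the greatest index
  at which the Gauss norm is attained. It is a relation here because it has no value at \<open>0\<close>.
\<close>

definition weierstrass_degree :: "('a::field \<Rightarrow> real) \<Rightarrow> real \<Rightarrow> 'a poly \<Rightarrow> nat \<Rightarrow> bool" where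
  "weierstrass_degree v r p n \<longleftrightarrow>
     (\<forall>i. v (poly.coeff p i) * r ^ i \<le> v (poly.coeff p n) * r ^ n) \<and>
     (\<forall>i>n. v (poly.coeff p i) * r ^ i < v (poly.coeff p n) * r ^ n)"

abbreviation recentre :: "'a::field \<Rightarrow> 'a poly \<Rightarrow> 'a poly" where
  "recentre a p \<equiv> pcompose p [:a, 1:]"

lemma proots_prod_linear: "proots (\<Prod>b\<in>#B. [:- b, 1:]) = (B :: 'a::idom multiset)"
proof (induction B)
  case (add b B)
  have "(\<Prod>b\<in>#B. [:- b, 1:]) \<noteq> 0" by (auto simp: prod_mset_zero_iff)
  hence "proots ([:- b, 1:] * (\<Prod>b\<in>#B. [:- b, 1:])) = proots [:- b, 1:] + B"
    using add by (subst proots_mult) auto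
  thus ?case by (simp only: image_mset_add_mset prod_mset.add_mset proots_linear_factor) simp
qed simp

lemma splits_over_proots:
  fixes p :: "'a::alg_closed_field poly"
  assumes "p \<noteq> 0"
  shows "p = Polynomial.smult (lead_coeff p) (\<Prod>b\<in>#proots p. [:- b, 1:])"
    and "size (proots p) = Polynomial.degree p"
proof -
  obtain B where B: "size B = Polynomial.degree p"
      "p = Polynomial.smult (lead_coeff p) (\<Prod>b\<in>#B. [:- b, 1:])"
    using alg_closed_imp_factorization[OF assms] by blast
  have "proots p = B"
    using assms by (subst B(2)) (simp add: proots_prod_linear)
  with B show "p = Polynomial.smult (lead_coeff p) (\<Prod>b\<in>#proots p. [:- b, 1:])"
    and "size (proots p) = Polynomial.degree p" by simp_all
qed

lemma degree_recentre [simp]: "Polynomial.degree (recentre a p) = Polynomial.degree p"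
  by (simp add: degree_pcompose)

lemma coeff_0_recentre [simp]: "poly.coeff (recentre a p) 0 = poly p a"
  by (simp add: pcompose_coeff_0)

lemma pcompose_as_sum:
  "pcompose p q = (\<Sum>i\<le>Polynomial.degree p. [:poly.coeff p i:] * q ^ i)"
proof -
  have "Polynomial.degree (map_poly (\<lambda>x. [:x:]) p) = Polynomial.degree p"
    by (rule degree_map_poly) simp
  thus ?thesis
    unfolding pcompose_altdef poly_altdef by (simp add: coeff_map_poly)
qed

lemma taylor_expansion:
  "p = (\<Sum>i\<le>Polynomial.degree p. [:poly.coeff (recentre a p) i:] * [:- a, 1:] ^ i)"
proof -
  have "p = pcompose (recentre a p) [:- a, 1:]"
    by (simp add: pcompose_pCons flip: pcompose_assoc)
  thus ?thesis using pcompose_as_sum[of "recentre a p" "[:- a, 1:]"] by simp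
qed

context complete_nonarch_field
begin

lemma weierstrass_degree_pos: "0 < v (poly.coeff p n) * r ^ n" if "weierstrass_degree v r p n" "0 < r"
proof -
  have "0 \<le> v (poly.coeff p (Suc n)) * r ^ Suc n" using that nonneg by simp
  also have "\<dots> < v (poly.coeff p n) * r ^ n" using that(1) unfolding weierstrass_degree_def by blast
  finally show ?thesis .
qed

lemma weierstrass_degree_unique:
  assumes "weierstrass_degree v r p n" "weierstrass_degree v r p m"
  shows "n = m"
proof (rule ccontr)
  assume "n \<noteq> m"
  thus False using assms unfolding weierstrass_degree_def
    by (metis linorder_neqE_nat linorder_not_less)
qed

lemma weierstrass_degree_exists:
  assumes "p \<noteq> 0" "0 < r"
  obtains n where "weierstrass_degree v r p n"
proof -
  let ?w = "\<lambda>i. v (poly.coeff p i) * r ^ i"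
  \<comment> \<open>The indices where the maximum is attained, of which the greatest is wanted.\<close>
  define S where "S = {i. i \<le> Polynomial.degree p \<and> (\<forall>j. ?w j \<le> ?w i)}"
  have w_high: "?w i = 0" if "i > Polynomial.degree p" for i
    using that by (simp add: coeff_eq_0)
  have w_nonneg: "0 \<le> ?w i" for i using nonneg assms by simp
  define M where "M = Max (?w ` {..Polynomial.degree p})"
  have "M \<in> ?w ` {..Polynomial.degree p}" unfolding M_def by (intro Max_in) auto
  then obtain i where i: "i \<le> Polynomial.degree p" "?w i = M" by auto
  have le: "?w j \<le> ?w i" for j
  proof (cases "j \<le> Polynomial.degree p")
    case True
    thus ?thesis unfolding i(2) M_def by (intro Max_ge) auto
  next
    case False
    thus ?thesis using w_high[of j] w_nonneg[of i] by linarith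
  qed
  have "S \<noteq> {}" "finite S" using i(1) le unfolding S_def by auto
  define n where "n = Max S"
  have "n \<in> S" unfolding n_def using \<open>S \<noteq> {}\<close> \<open>finite S\<close> by (rule Max_in[rotated])
  have wn: "?w j \<le> ?w n" for j using \<open>n \<in> S\<close> unfolding S_def by blast
  have pos: "0 < ?w n"
    using wn[of "Polynomial.degree p"] assms
    by (metis (no_types, lifting) leading_coeff_0_iff less_le_trans mult_pos_pos v_pos_iff zero_less_power)
  have "?w j < ?w n" if "j > n" for j
  proof -
    have "j \<notin> S" using that \<open>finite S\<close> unfolding n_def by (meson Max_ge linorder_not_less)
    show ?thesis
    proof (cases "j \<le> Polynomial.degree p")
      case True
      with \<open>j \<notin> S\<close> obtain k where "?w j < ?w k" unfolding S_def using linorder_not_less by blast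
      thus ?thesis using wn[of k] by linarith
    qed (use w_high[of j] pos in linarith)
  qed
  with wn that show ?thesis unfolding weierstrass_degree_def by blast
qed

text \<open>
  This is Gauss's lemma: in the coefficient of index \<open>n + m\<close> of the product, exactly one term
  has the largest possible value, and in the later coefficients none has.
\<close>

lemma weierstrass_degree_mult:
  assumes p: "weierstrass_degree v r p n" and q: "weierstrass_degree v r q m" and r: "0 < r"
  shows "weierstrass_degree v r (p * q) (n + m)"
    and "v (poly.coeff (p * q) (n + m)) * r ^ (n + m) =
      (v (poly.coeff p n) * r ^ n) * (v (poly.coeff q m) * r ^ m)"
proof -
  define A where "A = v (poly.coeff p n) * r ^ n"
  define B where "B = v (poly.coeff q m) * r ^ m"
  have A: "0 < A" and B: "0 < B"
    using weierstrass_degree_pos[OF p r] weierstrass_degree_pos[OF q r] by (simp_all add: A_def B_def)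
  have pA: "v (poly.coeff p i) * r ^ i \<le> A" and qB: "v (poly.coeff q i) * r ^ i \<le> B" for i
    using p q unfolding weierstrass_degree_def A_def B_def by blast+
  have pA': "v (poly.coeff p i) * r ^ i < A" if "i > n" for i
    using p that unfolding weierstrass_degree_def A_def by blast
  have qB': "v (poly.coeff q i) * r ^ i < B" if "i > m" for i
    using q that unfolding weierstrass_degree_def B_def by blast
  have nn: "0 \<le> v (poly.coeff h i) * r ^ i" for h i using nonneg r by simp
  have summand: "v (poly.coeff p j * poly.coeff q (i - j)) * r ^ i =
      (v (poly.coeff p j) * r ^ j) * (v (poly.coeff q (i - j)) * r ^ (i - j))" if "j \<le> i" for i j
    using that by (simp add: mult flip: power_add)
  have le: "v (poly.coeff p j * poly.coeff q (i - j)) \<le> A * B / r ^ i" if "j \<le> i" for i j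
  proof -
    have "v (poly.coeff p j * poly.coeff q (i - j)) * r ^ i \<le> A * B"
      unfolding summand[OF that] by (intro mult_mono pA qB nn) (use A in simp)
    thus ?thesis using r by (simp add: field_simps)
  qed
  have less: "v (poly.coeff p j * poly.coeff q (i - j)) < A * B / r ^ i"
    if "j \<le> i" "j > n \<or> i - j > m" for i j
  proof -
    have "(v (poly.coeff p j) * r ^ j) * (v (poly.coeff q (i - j)) * r ^ (i - j)) < A * B"
      using that(2)
    proof
      assume "j > n"
      have "(v (poly.coeff p j) * r ^ j) * (v (poly.coeff q (i - j)) * r ^ (i - j)) \<le>
          (v (poly.coeff p j) * r ^ j) * B"
        by (intro mult_left_mono qB nn)
      also have "\<dots> < A * B" using pA'[OF \<open>j > n\<close>] B by simp
      finally show ?thesis .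
    next
      assume "i - j > m"
      have "(v (poly.coeff p j) * r ^ j) * (v (poly.coeff q (i - j)) * r ^ (i - j)) \<le>
          A * (v (poly.coeff q (i - j)) * r ^ (i - j))"
        by (intro mult_right_mono pA nn)
      also have "\<dots> < A * B" using qB'[OF \<open>i - j > m\<close>] A by simp
      finally show ?thesis .
    qed
    hence "v (poly.coeff p j * poly.coeff q (i - j)) * r ^ i < A * B"
      unfolding summand[OF that(1)] .
    thus ?thesis using r by (simp add: field_simps)
  qed
  have c_le: "v (poly.coeff (p * q) i) \<le> A * B / r ^ i" for i
    unfolding coeff_mult by (intro v_sum_le le) (use A B r in auto)
  have c_less: "v (poly.coeff (p * q) i) < A * B / r ^ i" if "i > n + m" for i
    unfolding coeff_mult by (intro v_sum_less less) (use A B r that in auto)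
  have c_eq: "v (poly.coeff (p * q) (n + m)) = A * B / r ^ (n + m)"
  proof -
    have split: "poly.coeff (p * q) (n + m) =
        (\<Sum>j\<in>{..n + m} - {n}. poly.coeff p j * poly.coeff q (n + m - j)) + poly.coeff p n * poly.coeff q m"
      unfolding coeff_mult by (subst sum.remove[of _ n]) (auto simp: add.commute)
    have top: "v (poly.coeff p n * poly.coeff q m) = A * B / r ^ (n + m)"
      using r by (simp add: A_def B_def mult power_add)
    have rest: "v (\<Sum>j\<in>{..n + m} - {n}. poly.coeff p j * poly.coeff q (n + m - j)) < A * B / r ^ (n + m)"
    proof (intro v_sum_less less)
      fix j assume "j \<in> {..n + m} - {n}"
      thus "n < j \<or> m < n + m - j" by auto
    qed (use A B r in auto)
    show ?thesis unfolding split using v_add_eq_right rest unfolding top[symmetric] by blast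
  qed
  show eq: "v (poly.coeff (p * q) (n + m)) * r ^ (n + m) =
      (v (poly.coeff p n) * r ^ n) * (v (poly.coeff q m) * r ^ m)"
    using c_eq r by (simp add: A_def B_def)
  show "weierstrass_degree v r (p * q) (n + m)"
    unfolding weierstrass_degree_def eq A_def[symmetric] B_def[symmetric]
    using c_le c_less r by (simp add: field_simps)
qed

text \<open>
  A positive Weierstrass degree survives any change of the constant term that stays within the Gauss
  norm. This allows \<open>f - f a\<close> to be replaced by \<open>f - b\<close> for any \<open>b\<close> in the image disc.
\<close>

lemma weierstrass_degree_cong_const:
  assumes "weierstrass_degree v r p n" "0 < n" "v c \<le> v (poly.coeff p n) * r ^ n"
    and "\<And>i. 0 < i \<Longrightarrow> poly.coeff q i = poly.coeff p i" "poly.coeff q 0 = c"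
  shows "weierstrass_degree v r q n"
  unfolding weierstrass_degree_def
proof (intro conjI allI impI)
  fix i
  show "v (poly.coeff q i) * r ^ i \<le> v (poly.coeff q n) * r ^ n"
    using assms by (cases "i = 0") (auto simp: weierstrass_degree_def)
  show "v (poly.coeff q i) * r ^ i < v (poly.coeff q n) * r ^ n" if "n < i"
    using assms that by (auto simp: weierstrass_degree_def)
qed

lemma weierstrass_degree_linear:
  assumes "0 < r"
  shows "weierstrass_degree v r [:- b, 1:] (if v b \<le> r then 1 else 0)"
  unfolding weierstrass_degree_def
  using assms by (auto simp: coeff_pCons not_le split: nat.splits)

lemma weierstrass_degree_const:
  assumes "0 < r" "c \<noteq> 0"
  shows "weierstrass_degree v r [:c:] 0"
  unfolding weierstrass_degree_def
  using assms by (auto simp: coeff_pCons not_le nonneg split: nat.splits)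

text \<open>
  By multiplicativity it suffices to look at the linear factors: the Weierstrass degree counts the
  zeros in the closed disc.
\<close>

lemma weierstrass_degree_eq_number_of_roots:
  assumes "p \<noteq> 0" "0 < r"
  shows "weierstrass_degree v r (recentre a p) (size {#b \<in># proots p. v (b - a) \<le> r#})"
proof -
  have prod: "weierstrass_degree v r (recentre a (\<Prod>b\<in>#B. [:- b, 1:])) (size {#b \<in># B. v (b - a) \<le> r#})"
    for B
  proof (induction B)
    case empty
    show ?case using weierstrass_degree_const[OF assms(2), of 1] by (simp add: pcompose_1 one_pCons)
  next
    case (add b B)
    have "recentre a [:- b, 1:] = [:- (b - a), 1:]"
      by (simp add: pcompose_pCons)
    hence "recentre a (\<Prod>b\<in>#add_mset b B. [:- b, 1:]) =
        [:- (b - a), 1:] * recentre a (\<Prod>b\<in>#B. [:- b, 1:])"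
      by (simp only: image_mset_add_mset prod_mset.add_mset pcompose_mult)
    moreover have "size {#b \<in># add_mset b B. v (b - a) \<le> r#} =
        (if v (b - a) \<le> r then 1 else 0) + size {#b \<in># B. v (b - a) \<le> r#}"
      by simp
    ultimately show ?case
      using weierstrass_degree_mult(1)[OF weierstrass_degree_linear add assms(2)] assms(2) by metis
  qed
  have "recentre a p = recentre a (Polynomial.smult (lead_coeff p) (\<Prod>b\<in>#proots p. [:- b, 1:]))"
    using splits_over_proots(1)[OF assms(1)] by simp
  also have "\<dots> = [:lead_coeff p:] * recentre a (\<Prod>b\<in>#proots p. [:- b, 1:])"
    by (simp add: pcompose_smult)
  finally have eq: "recentre a p = [:lead_coeff p:] * recentre a (\<Prod>b\<in>#proots p. [:- b, 1:])" .
  have "lead_coeff p \<noteq> 0" using assms(1) by simp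
  from weierstrass_degree_mult(1)[OF weierstrass_degree_const[OF assms(2) this] prod[of "proots p"] assms(2)]
  show ?thesis unfolding eq by simp
qed

end

section \<open>Points of the Berkovich line\<close>

context complete_nonarch_field
begin

lemma disc_seminorm_eq:
  assumes "weierstrass_degree v r (recentre a p) n" "0 < r"
  shows "disc_seminorm v a r p = v (poly.coeff (recentre a p) n) * r ^ n"
  unfolding disc_seminorm_def
proof (rule Max_eqI)
  have "n \<le> Polynomial.degree p"
    using weierstrass_degree_pos[OF assms] coeff_eq_0[of "recentre a p" n] by (fastforce simp: not_le)
  thus "v (poly.coeff (recentre a p) n) * r ^ n
      \<in> (\<lambda>i. v (poly.coeff (recentre a p) i) * r ^ i) ` {..Polynomial.degree p}" by blast
qed (use assms(1) in \<open>auto simp: weierstrass_degree_def\<close>)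

lemma disc_seminorm_le_iff:
  assumes "0 \<le> r" "0 \<le> B"
  shows "disc_seminorm v a r p \<le> B \<longleftrightarrow> (\<forall>i. v (poly.coeff (recentre a p) i) * r ^ i \<le> B)"
proof -
  have "v (poly.coeff (recentre a p) i) * r ^ i = 0" if "i > Polynomial.degree p" for i
    using that by (simp add: coeff_eq_0)
  with assms(2) have "(\<forall>i\<le>Polynomial.degree p. v (poly.coeff (recentre a p) i) * r ^ i \<le> B) \<longleftrightarrow>
      (\<forall>i. v (poly.coeff (recentre a p) i) * r ^ i \<le> B)"
    by (metis linorder_not_less)
  thus ?thesis unfolding disc_seminorm_def by (subst Max_le_iff) auto
qed

lemma disc_seminorm_nonneg: "0 \<le> disc_seminorm v a r p" if "0 \<le> r"
proof -
  have "0 \<le> v (poly.coeff (recentre a p) 0) * r ^ 0" by (simp add: nonneg)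
  also have "\<dots> \<le> disc_seminorm v a r p" unfolding disc_seminorm_def by (intro Max_ge imageI finite_imageI) auto
  finally show ?thesis .
qed

lemma coeff_le_disc_seminorm:
  "v (poly.coeff (recentre a p) i) * r ^ i \<le> disc_seminorm v a r p" if "0 \<le> r"
  using disc_seminorm_le_iff[OF that disc_seminorm_nonneg[OF that], of a p a p] by simp

lemma disc_seminorm_0 [simp]: "disc_seminorm v a r 0 = 0"
  by (simp add: disc_seminorm_def)

lemma disc_seminorm_const [simp]: "disc_seminorm v a r [:c:] = v c"
  by (simp add: disc_seminorm_def)

lemma disc_seminorm_linear:
  assumes "0 \<le> r"
  shows "disc_seminorm v a r [:- b, 1:] = max (v (a - b)) r"
proof -
  have "{..Polynomial.degree [:- b, 1:]} = {0, 1}" by auto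
  moreover have "recentre a [:- b, 1:] = [:a - b, 1:]" by (simp add: pcompose_pCons)
  ultimately show ?thesis unfolding disc_seminorm_def by simp
qed

lemma multiplicative_seminorm_disc: "multiplicative_seminorm v (disc_seminorm v a r)" if r: "0 < r"
  unfolding multiplicative_seminorm_def
proof (intro conjI allI)
  fix p q :: "'a poly"
  show "disc_seminorm v a r (p * q) = disc_seminorm v a r p * disc_seminorm v a r q"
  proof (cases "p = 0 \<or> q = 0")
    case False
    hence "recentre a p \<noteq> 0" "recentre a q \<noteq> 0" by (auto simp: pcompose_eq_0_iff)
    then obtain n m where "weierstrass_degree v r (recentre a p) n" "weierstrass_degree v r (recentre a q) m"
      using weierstrass_degree_exists r by metis
    thus ?thesis
      using weierstrass_degree_mult[of r "recentre a p" n "recentre a q" m] r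
      by (simp add: disc_seminorm_eq pcompose_mult)
  qed auto
  have "disc_seminorm v a r (p + q) \<le> max (disc_seminorm v a r p) (disc_seminorm v a r q)"
  proof (subst disc_seminorm_le_iff, goal_cases)
    case 3
    show ?case
    proof
      fix i
      have "v (poly.coeff (recentre a (p + q)) i) * r ^ i \<le>
          max (v (poly.coeff (recentre a p) i)) (v (poly.coeff (recentre a q) i)) * r ^ i"
        using r by (intro mult_right_mono) (simp_all add: pcompose_add ultrametric)
      also have "\<dots> = max (v (poly.coeff (recentre a p) i) * r ^ i) (v (poly.coeff (recentre a q) i) * r ^ i)"
        using r by (simp add: max_mult_distrib_right)
      also have "\<dots> \<le> max (disc_seminorm v a r p) (disc_seminorm v a r q)"
        using coeff_le_disc_seminorm[of r] r by (intro max.mono) auto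
      finally show "v (poly.coeff (recentre a (p + q)) i) * r ^ i \<le> \<dots>" .
    qed
  qed (use r disc_seminorm_nonneg[of r a p] in auto)
  thus "disc_seminorm v a r (p + q) \<le> disc_seminorm v a r p + disc_seminorm v a r q"
    using disc_seminorm_nonneg[of r a] r by (smt (verit))
qed (use r in \<open>auto intro: disc_seminorm_nonneg\<close>)

lemma multiplicative_seminorm_evaluation: "multiplicative_seminorm v (evaluation_seminorm v a)"
  using ultrametric[of "poly _ a" "poly _ a"] nonneg
  unfolding multiplicative_seminorm_def evaluation_seminorm_def
  by (auto simp: mult intro: order_trans[OF ultrametric])

lemma evaluation_seminorm_inject [simp]:
  "evaluation_seminorm v a = evaluation_seminorm v b \<longleftrightarrow> a = b"
proof
  assume "evaluation_seminorm v a = evaluation_seminorm v b"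
  from fun_cong[OF this, of "[:- a, 1:]"] show "a = b"
    by (simp add: evaluation_seminorm_def)
qed simp

lemma the_evaluation_point [simp]:
  "(THE a'. evaluation_seminorm v a = evaluation_seminorm v a') = a"
  by simp

lemma type_I_evaluation [simp]: "type_I v (evaluation_seminorm v a)"
  by (auto simp: type_I_def)

lemma not_type_I_disc [simp]: "\<not> type_I v (disc_seminorm v a r)" if "0 < r"
proof
  assume "type_I v (disc_seminorm v a r)"
  then obtain b where "disc_seminorm v a r = evaluation_seminorm v b" unfolding type_I_def by blast
  from fun_cong[OF this, of "[:- b, 1:]"] show False
    using that by (simp add: disc_seminorm_linear evaluation_seminorm_def)
qed

context
  fixes x :: "'a poly \<Rightarrow> real"
  assumes x: "multiplicative_seminorm v x"
begin

lemma seminorm_nonneg: "0 \<le> x p"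
  and seminorm_const [simp]: "x [:c:] = v c"
  and seminorm_mult: "x (p * q) = x p * x q"
  and seminorm_triangle: "x (p + q) \<le> x p + x q"
  using x unfolding multiplicative_seminorm_def by blast+

lemma seminorm_0 [simp]: "x 0 = 0"
  using seminorm_const[of 0] by simp

lemma seminorm_1 [simp]: "x 1 = 1"
  using seminorm_const[of 1] by (simp add: one_pCons)

lemma seminorm_power [simp]: "x (p ^ n) = x p ^ n"
  by (induction n) (simp_all add: seminorm_mult)

lemma seminorm_uminus [simp]: "x (- p) = x p"
  using seminorm_mult[of "[:- 1:]" p] by simp

text \<open>
  The triangle inequality improves itself: in the binomial expansion of \<open>(p + q)^n\<close> the integer
  coefficients have value at most \<open>1\<close>, so \<open>x (p + q)^n \<le> (n + 1) M^n\<close> for the maximum \<open>M\<close>, and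
  the factor \<open>n + 1\<close> disappears in the limit.
\<close>

lemma seminorm_ultrametric: "x (p + q) \<le> max (x p) (x q)"
proof (rule ccontr)
  define M where "M = max (x p) (x q)"
  assume "\<not> x (p + q) \<le> max (x p) (x q)"
  hence less: "M < x (p + q)" unfolding M_def by linarith
  have M: "0 \<le> M" "x p \<le> M" "x q \<le> M" using seminorm_nonneg[of p] by (auto simp: M_def)
  have "M \<noteq> 0" using less seminorm_triangle[of p q] M by auto
  with M have "0 < M" by simp
  have sum_le: "x (sum h A) \<le> (\<Sum>i\<in>A. x (h i))" for h :: "nat \<Rightarrow> 'a poly" and A
    by (induction A rule: infinite_finite_induct) (auto intro: order_trans[OF seminorm_triangle])
  have bound: "x (p + q) ^ n \<le> real (n + 1) * M ^ n" for n
  proof -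
    have "x (p + q) ^ n = x (\<Sum>k\<le>n. of_nat (n choose k) * p ^ k * q ^ (n - k))"
      by (simp flip: binomial_ring)
    also have "\<dots> \<le> (\<Sum>k\<le>n. x (of_nat (n choose k) * p ^ k * q ^ (n - k)))"
      by (rule sum_le)
    also have "\<dots> \<le> (\<Sum>k\<le>n. M ^ n)"
    proof (rule sum_mono)
      fix k assume "k \<in> {..n}"
      hence "M ^ n = 1 * M ^ k * M ^ (n - k)" by (simp flip: power_add)
      moreover have "x (of_nat (n choose k) * p ^ k * q ^ (n - k)) =
          v (of_nat (n choose k)) * x p ^ k * x q ^ (n - k)"
        unfolding of_nat_poly by (simp only: seminorm_mult seminorm_power seminorm_const)
      ultimately show "x (of_nat (n choose k) * p ^ k * q ^ (n - k)) \<le> M ^ n"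
        using M by (simp only:) (intro mult_mono power_mono v_of_nat_le_1; simp add: seminorm_nonneg nonneg)
    qed
    finally show ?thesis by simp
  qed
  define \<rho> where "\<rho> = x (p + q) / M"
  have "1 < \<rho>" using less \<open>0 < M\<close> by (simp add: \<rho>_def)
  have "\<rho> ^ n \<le> real (n + 1)" for n
    using bound[of n] \<open>0 < M\<close> by (simp add: \<rho>_def power_divide field_simps)
  moreover have "(\<lambda>n. of_nat n / \<rho> ^ n) \<longlonglongrightarrow> 0"
    using \<open>1 < \<rho>\<close> lim_n_over_pown[of \<rho>] by simp
  hence "eventually (\<lambda>n. real n / \<rho> ^ n < 1 / 2) sequentially"
    by (rule order_tendstoD) simp
  hence "eventually (\<lambda>n. real n / \<rho> ^ n < 1 / 2 \<and> n \<ge> 2) sequentially"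
    using eventually_ge_at_top[of 2] by eventually_elim auto
  then obtain n where "real n / \<rho> ^ n < 1 / 2" "n \<ge> 2"
    by (metis (mono_tags, lifting) eventually_happens sequentially_bot)
  moreover from this have "2 * real n < \<rho> ^ n" using \<open>1 < \<rho>\<close> by (simp add: field_simps)
  ultimately show False by (smt (verit) of_nat_1 of_nat_add of_nat_mono one_add_one)
qed

lemma seminorm_ultrametric_diff: "x (p - q) \<le> max (x p) (x q)"
  using seminorm_ultrametric[of p "- q"] by simp

lemma seminorm_eq_of_less: "x (p + q) = x q" if "x p < x q"
proof (rule antisym)
  show "x (p + q) \<le> x q" using seminorm_ultrametric[of p q] that by simp
  have "x q \<le> max (x (p + q)) (x p)"
    using seminorm_ultrametric_diff[of "p + q" p] by simp
  thus "x q \<le> x (p + q)" using that by linarith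
qed

text \<open>
  The disc seminorm is the largest multiplicative seminorm that gives \<open>z - a\<close> a value of at most \<open>r\<close>, by
  the ultrametric, by the
  ultrametric inequality in the Taylor expansion at \<open>a\<close>.
\<close>

lemma seminorm_le_disc:
  assumes "x [:- a, 1:] \<le> r"
  shows "x p \<le> disc_seminorm v a r p"
proof -
  have r: "0 \<le> r" using assms seminorm_nonneg order_trans by blast
  have "x ([:poly.coeff (recentre a p) i:] * [:- a, 1:] ^ i) \<le> disc_seminorm v a r p" for i
  proof -
    have "x ([:poly.coeff (recentre a p) i:] * [:- a, 1:] ^ i) =
        v (poly.coeff (recentre a p) i) * x [:- a, 1:] ^ i"
      by (simp only: seminorm_mult seminorm_power seminorm_const)
    also have "\<dots> \<le> v (poly.coeff (recentre a p) i) * r ^ i"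
      using assms seminorm_nonneg nonneg by (intro mult_left_mono power_mono) auto
    also have "\<dots> \<le> disc_seminorm v a r p" by (rule coeff_le_disc_seminorm[OF r])
    finally show ?thesis .
  qed
  thus ?thesis
    by (subst taylor_expansion[of p a], intro ultrametric_sum_le[of x] seminorm_ultrametric)
      (use disc_seminorm_nonneg[OF r] in auto)
qed

end

text \<open>
  Over an algebraically closed field every polynomial is a product of linear ones, so a point of the
  Berkovich line is determined by its distances \<open>x (z - b)\<close> to the classical points.
\<close>

lemma seminorm_eqI:
  assumes "multiplicative_seminorm v x" "multiplicative_seminorm v y"
    and "\<And>b. x [:- b, 1:] = y [:- b, 1:]"
  shows "x = y"
proof
  fix p
  have prod: "x (\<Prod>b\<in>#B. [:- b, 1:]) = y (\<Prod>b\<in>#B. [:- b, 1:])" for B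
  proof (induction B)
    case empty
    show ?case using assms by (simp add: seminorm_1)
  next
    case (add b B)
    thus ?case using assms
      by (simp only: image_mset_add_mset prod_mset.add_mset seminorm_mult)
  qed
  show "x p = y p"
  proof (cases "p = 0")
    case True
    thus ?thesis using assms by (simp add: seminorm_0)
  next
    case False
    have "p = [:lead_coeff p:] * (\<Prod>b\<in>#proots p. [:- b, 1:])"
      using splits_over_proots(1)[OF False] by simp
    hence "x p = v (lead_coeff p) * x (\<Prod>b\<in>#proots p. [:- b, 1:])"
      and "y p = v (lead_coeff p) * y (\<Prod>b\<in>#proots p. [:- b, 1:])"
      using seminorm_mult[OF assms(1)] seminorm_mult[OF assms(2)]
        seminorm_const[OF assms(1)] seminorm_const[OF assms(2)] by metis+
    thus ?thesis using prod by simp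
  qed
qed

lemma disc_seminorm_eq_iff:
  assumes "0 < r" "0 < s"
  shows "disc_seminorm v a r = disc_seminorm v b s \<longleftrightarrow> r = s \<and> v (a - b) \<le> r"
proof
  assume eq: "disc_seminorm v a r = disc_seminorm v b s"
  have "max 0 r = max (v (b - a)) s" "max (v (a - b)) r = max 0 s"
    using fun_cong[OF eq, of "[:- a, 1:]"] fun_cong[OF eq, of "[:- b, 1:]"] assms
    by (simp_all add: disc_seminorm_linear)
  thus "r = s \<and> v (a - b) \<le> r"
    using assms v_minus_commute[of a b] by linarith
next
  assume *: "r = s \<and> v (a - b) \<le> r"
  have "max (v (a - t)) r = max (v (b - t)) r" for t
    using ultrametric[of "a - b" "b - t"] v_diff_le[of "a - t" "a - b"] * by auto
  with * assms show "disc_seminorm v a r = disc_seminorm v b s"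
    by (intro seminorm_eqI multiplicative_seminorm_disc) (simp_all add: disc_seminorm_linear)
qed

lemma multiplicative_seminorm_pushforward:
  "multiplicative_seminorm v x \<Longrightarrow> multiplicative_seminorm v (pushforward f x)"
  unfolding multiplicative_seminorm_def pushforward_def
  by (auto simp: pcompose_mult pcompose_add)

lemma pushforward_evaluation:
  "pushforward f (evaluation_seminorm v a) = evaluation_seminorm v (poly f a)"
  by (auto simp: pushforward_def evaluation_seminorm_def poly_pcompose)

lemma pushforward_linear: "pushforward f x [:- b, 1:] = x (f - [:b:])"
proof -
  have "pcompose [:- b, 1:] f = f - [:b:]"
    by (simp add: pcompose_pCons diff_conv_add_uminus del: add_uminus_conv_diff)
  thus ?thesis by (simp add: pushforward_def)
qed

lemma disc_seminorm_pos: "0 < disc_seminorm v a r p" if "0 < r" "p \<noteq> 0"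
proof -
  have "recentre a p \<noteq> 0" using that by (auto simp: pcompose_eq_0_iff)
  with that show ?thesis
    by (metis disc_seminorm_eq weierstrass_degree_exists weierstrass_degree_pos)
qed

lemma disc_seminorm_diff_const:
  assumes "0 < r"
  shows "disc_seminorm v a r (f - [:b:]) = max (v (poly f a - b)) (disc_seminorm v a r (f - [:poly f a:]))"
proof (rule antisym)
  note ms = multiplicative_seminorm_disc[OF assms, of a]
  have "f - [:b:] = (f - [:poly f a:]) + [:poly f a - b:]" by simp
  thus "disc_seminorm v a r (f - [:b:]) \<le> max (v (poly f a - b)) (disc_seminorm v a r (f - [:poly f a:]))"
    using seminorm_ultrametric[OF ms, of "f - [:poly f a:]" "[:poly f a - b:]"]
    by (metis max.commute disc_seminorm_const)
  have 1: "v (poly f a - b) \<le> disc_seminorm v a r (f - [:b:])"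
    using coeff_le_disc_seminorm[of r "f - [:b:]" a 0] assms by simp
  have "f - [:poly f a:] = (f - [:b:]) - [:poly f a - b:]" by simp
  hence "disc_seminorm v a r (f - [:poly f a:]) \<le> max (disc_seminorm v a r (f - [:b:])) (v (poly f a - b))"
    using seminorm_ultrametric_diff[OF ms, of "f - [:b:]" "[:poly f a - b:]"]
    by (metis disc_seminorm_const)
  with 1 show "max (v (poly f a - b)) (disc_seminorm v a r (f - [:poly f a:])) \<le> disc_seminorm v a r (f - [:b:])"
    by simp
qed

text \<open>
  Both sides give \<open>z - b\<close> the larger of \<open>v (f a - b)\<close> and the Gauss norm of \<open>f - f a\<close>.
\<close>

lemma pushforward_disc:
  assumes "0 < r" "0 < Polynomial.degree f"
  shows "pushforward f (disc_seminorm v a r) =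
    disc_seminorm v (poly f a) (disc_seminorm v a r (f - [:poly f a:]))"
proof (rule seminorm_eqI)
  have "f \<noteq> [:poly f a:]" using assms(2) degree_pCons_0[of "poly f a"] by force
  hence "f - [:poly f a:] \<noteq> 0" by simp
  hence pos: "0 < disc_seminorm v a r (f - [:poly f a:])" using assms(1) disc_seminorm_pos by blast
  show "multiplicative_seminorm v (pushforward f (disc_seminorm v a r))"
    using assms by (intro multiplicative_seminorm_pushforward multiplicative_seminorm_disc)
  show "multiplicative_seminorm v (disc_seminorm v (poly f a) (disc_seminorm v a r (f - [:poly f a:])))"
    using pos by (rule multiplicative_seminorm_disc)
  show "pushforward f (disc_seminorm v a r) [:- b, 1:] =
      disc_seminorm v (poly f a) (disc_seminorm v a r (f - [:poly f a:])) [:- b, 1:]" for b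
    unfolding pushforward_linear disc_seminorm_linear[OF less_imp_le[OF pos]]
    by (rule disc_seminorm_diff_const[OF assms(1)])
qed

end

section \<open>Reduction modulo the maximal ideal\<close>

context complete_nonarch_field
begin

lemma cring_valuation_ring: "cring (valuation_ring v)"
proof (rule cringI)
  show "abelian_group (valuation_ring v)"
  proof (rule abelian_groupI)
    fix x assume "x \<in> carrier (valuation_ring v)"
    thus "\<exists>y\<in>carrier (valuation_ring v). y \<oplus>\<^bsub>valuation_ring v\<^esub> x = \<zero>\<^bsub>valuation_ring v\<^esub>"
      by (intro bexI[of _ "- x"]) (auto simp: valuation_ring_def)
  qed (auto simp: valuation_ring_def add_ac intro: order_trans[OF ultrametric])
  show "comm_monoid (valuation_ring v)"
    by (rule comm_monoidI)
      (auto simp: valuation_ring_def mult mult_ac nonneg intro: mult_le_one)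
qed (auto simp: valuation_ring_def algebra_simps)

lemma ideal_maximal_ideal: "ideal (maximal_ideal v) (valuation_ring v)"
proof (rule idealI)
  interpret cring "valuation_ring v" by (rule cring_valuation_ring)
  show "ring (valuation_ring v)" by (rule ring_axioms)
  show "subgroup (maximal_ideal v) (add_monoid (valuation_ring v))"
  proof (rule add.subgroupI)
    fix a assume a: "a \<in> maximal_ideal v"
    hence "\<ominus>\<^bsub>valuation_ring v\<^esub> a = - a"
      by (intro minus_equality) (auto simp: valuation_ring_def maximal_ideal_def)
    with a show "\<ominus>\<^bsub>valuation_ring v\<^esub> a \<in> maximal_ideal v" by (simp add: maximal_ideal_def)
  next
    fix a b assume "a \<in> maximal_ideal v" "b \<in> maximal_ideal v"
    thus "a \<oplus>\<^bsub>valuation_ring v\<^esub> b \<in> maximal_ideal v"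
      using ultrametric[of a b] by (auto simp: maximal_ideal_def valuation_ring_def)
  next
    have "0 \<in> maximal_ideal v" by (simp add: maximal_ideal_def)
    thus "maximal_ideal v \<noteq> {}" by blast
  qed (auto simp: maximal_ideal_def valuation_ring_def)
  fix a x assume "a \<in> maximal_ideal v" "x \<in> carrier (valuation_ring v)"
  hence "v a < 1" "v x \<le> 1" by (auto simp: maximal_ideal_def valuation_ring_def)
  hence "v x * v a < 1"
    using nonneg[of a] nonneg[of x] by (metis le_less_trans mult_left_le_one_le)
  thus "x \<otimes>\<^bsub>valuation_ring v\<^esub> a \<in> maximal_ideal v" "a \<otimes>\<^bsub>valuation_ring v\<^esub> x \<in> maximal_ideal v"
    by (auto simp: maximal_ideal_def valuation_ring_def mult mult.commute)
qed

lemma cring_residue_field: "cring (residue_field v)"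
  unfolding residue_field_def
  by (intro ideal.quotient_is_cring ideal_maximal_ideal cring_valuation_ring)

lemma residue_hom: "ring_hom_cring (valuation_ring v) (residue_field v) (residue v)"
  unfolding residue_field_def residue_def[abs_def]
  by (intro ideal.rcos_ring_hom_cring ideal_maximal_ideal cring_valuation_ring)

lemma residue_eq: "residue v a = {b. v (b - a) < 1}"
proof -
  have "b \<in> residue v a \<longleftrightarrow> v (b - a) < 1" for b
    unfolding residue_def a_r_coset_def' valuation_ring_def maximal_ideal_def
    by (auto intro: exI[of _ "b - a"])
  thus ?thesis by blast
qed

lemma residue_eq_iff: "residue v a = residue v b \<longleftrightarrow> v (a - b) < 1"
proof
  assume "residue v a = residue v b"
  moreover have "a \<in> residue v a" by (simp add: residue_eq)
  ultimately show "v (a - b) < 1" by (simp add: residue_eq)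
next
  assume *: "v (a - b) < 1"
  have "v (c - a) < 1 \<longleftrightarrow> v (c - b) < 1" for c
    using ultrametric[of "c - a" "a - b"] v_diff_le[of "c - b" "a - b"] * by auto
  thus "residue v a = residue v b" by (simp add: residue_eq)
qed

lemma carrier_residue_field: "carrier (residue_field v) = residue v ` {a. v a \<le> 1}"
proof -
  have "carrier (valuation_ring v) = {a. v a \<le> 1}" by (simp add: valuation_ring_def)
  thus ?thesis
    unfolding residue_field_def FactRing_def A_RCOSETS_def' residue_def[abs_def] by auto
qed

lemma residue_zero: "\<zero>\<^bsub>residue_field v\<^esub> = residue v 0"
  and residue_add: "v a \<le> 1 \<Longrightarrow> v b \<le> 1 \<Longrightarrow>
    residue v a \<oplus>\<^bsub>residue_field v\<^esub> residue v b = residue v (a + b)"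
  and residue_mult: "v a \<le> 1 \<Longrightarrow> v b \<le> 1 \<Longrightarrow>
    residue v a \<otimes>\<^bsub>residue_field v\<^esub> residue v b = residue v (a * b)"
  and residue_power: "v a \<le> 1 \<Longrightarrow> residue v a [^]\<^bsub>residue_field v\<^esub> n = residue v (a ^ n)"
proof -
  interpret ring_hom_cring "valuation_ring v" "residue_field v" "residue v" by (rule residue_hom)
  show "\<zero>\<^bsub>residue_field v\<^esub> = residue v 0"
    using hom_zero by (simp add: valuation_ring_def)
  show "residue v a \<oplus>\<^bsub>residue_field v\<^esub> residue v b = residue v (a + b)" if "v a \<le> 1" "v b \<le> 1"
    using hom_add[of a b] that by (simp add: valuation_ring_def)
  show mult: "residue v a \<otimes>\<^bsub>residue_field v\<^esub> residue v b = residue v (a * b)" if "v a \<le> 1" "v b \<le> 1" for a b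
    using hom_mult[of a b] that by (simp add: valuation_ring_def)
  show "residue v a [^]\<^bsub>residue_field v\<^esub> n = residue v (a ^ n)" if "v a \<le> 1"
  proof (induction n)
    case 0
    show ?case using hom_one by (simp add: valuation_ring_def)
  next
    case (Suc n)
    have "v (a ^ n) \<le> 1" using that nonneg by (simp add: power_le_one)
    thus ?case using mult[of "a ^ n" a] Suc that by (simp add: mult.commute)
  qed
qed

definition reduction :: "'a poly \<Rightarrow> nat \<Rightarrow> 'a set" where
  "reduction P = (\<lambda>i. residue v (poly.coeff P i))"

definition integral_poly :: "'a poly \<Rightarrow> bool" where
  "integral_poly P \<longleftrightarrow> (\<forall>i. v (poly.coeff P i) \<le> 1)"

lemma reduction_in_carrier:
  assumes "integral_poly P"
  shows "reduction P \<in> carrier (UP (residue_field v))"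
proof -
  have "bound \<zero>\<^bsub>residue_field v\<^esub> (Polynomial.degree P) (reduction P)"
    by (auto simp: reduction_def coeff_eq_0 residue_zero)
  with assms show ?thesis
    unfolding UP_def integral_poly_def
    by (auto intro!: mem_upI simp: carrier_residue_field reduction_def)
qed

text \<open>
  Lifting coefficients turns statements about polynomials over the residue field into statements
  about polynomials over the valuation ring.
\<close>

lemma reduction_surj:
  assumes "p \<in> carrier (UP (residue_field v))"
  obtains P where "integral_poly P" "p = reduction P"
proof -
  from assms have up: "p \<in> up (residue_field v)" by (simp add: UP_def)
  then obtain n where n: "bound \<zero>\<^bsub>residue_field v\<^esub> n p" unfolding up_def by blast
  have "\<exists>a. v a \<le> 1 \<and> p i = residue v a" for i
    using mem_upD[OF up, of i] by (auto simp: carrier_residue_field)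
  then obtain l where l: "v (l i) \<le> 1" "p i = residue v (l i)" for i by metis
  define P where "P = (\<Sum>i\<le>n. Polynomial.monom (l i) i)"
  have coeff: "poly.coeff P i = (if i \<le> n then l i else 0)" for i
    unfolding P_def by (simp add: coeff_sum)
  have "p i = reduction P i" for i
    using bound.bound[OF n, of i] l(2)[of i] by (auto simp: reduction_def coeff residue_zero not_le)
  moreover have "integral_poly P" unfolding integral_poly_def using l(1) by (auto simp: coeff)
  ultimately show ?thesis using that by blast
qed

lemma integral_poly_eval: "v (poly P b) \<le> 1" if "integral_poly P" "v b \<le> 1"
proof -
  have "v (poly.coeff P i * b ^ i) \<le> 1" for i
    using that by (simp add: integral_poly_def mult mult_le_one nonneg power_le_one)
  thus ?thesis unfolding poly_altdef by (intro v_sum_le) auto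
qed

lemma coeff_reduction: "up_ring.coeff (UP (residue_field v)) (reduction P) = reduction P"
  if "integral_poly P"
  using reduction_in_carrier[OF that] by (auto simp: UP_def)

text \<open>
  Evaluation over the residue field stops at the degree of the reduction, whereas \<open>P\<close> may have further
  coefficients; these lie in the maximal ideal and do not change the residue of the value.
\<close>

lemma eval_reduction:
  assumes P: "integral_poly P" and b: "v b \<le> 1"
  shows "eval (residue_field v) (residue_field v) id (residue v b) (reduction P) = residue v (poly P b)"
proof -
  interpret S: cring "residue_field v" by (rule cring_residue_field)
  interpret UP_cring "residue_field v" "UP (residue_field v)" by unfold_locales simp_all
  define N where "N = deg (residue_field v) (reduction P)"
  have vt: "v (poly.coeff P i * b ^ i) \<le> 1" for i
    using P b by (simp add: integral_poly_def mult mult_le_one nonneg power_le_one)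
  have summand: "reduction P i \<otimes>\<^bsub>residue_field v\<^esub> residue v b [^]\<^bsub>residue_field v\<^esub> i =
      residue v (poly.coeff P i * b ^ i)" for i
    using P b by (simp add: reduction_def residue_power residue_mult integral_poly_def power_le_one nonneg)
  have part: "v (\<Sum>i\<le>m. poly.coeff P i * b ^ i) \<le> 1" for m
    using vt by (intro v_sum_le) auto
  have fin: "(\<Oplus>\<^bsub>residue_field v\<^esub>i\<in>{..m}. residue v (poly.coeff P i * b ^ i)) =
      residue v (\<Sum>i\<le>m. poly.coeff P i * b ^ i)" for m
  proof (induction m)
    case 0
    show ?case using vt[of 0] by (simp add: carrier_residue_field)
  next
    case (Suc m)
    thus ?case using vt part[of m]
      by (subst S.finsum_Suc) (auto simp: carrier_residue_field residue_add add.commute simp del: power_Suc)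
  qed
  have "residue v (\<Sum>i\<le>N. poly.coeff P i * b ^ i) = residue v (poly P b)"
  proof -
    define D where "D = max N (Polynomial.degree P)"
    have "poly P b = (\<Sum>i\<le>D. poly.coeff P i * b ^ i)"
      unfolding poly_altdef by (rule sum.mono_neutral_left) (auto simp: D_def coeff_eq_0 not_le)
    also have "\<dots> = (\<Sum>i\<le>N. poly.coeff P i * b ^ i) + (\<Sum>i\<in>{N<..D}. poly.coeff P i * b ^ i)"
      by (subst sum.union_disjoint[symmetric]) (auto intro!: sum.cong simp: D_def)
    finally have "poly P b - (\<Sum>i\<le>N. poly.coeff P i * b ^ i) = (\<Sum>i\<in>{N<..D}. poly.coeff P i * b ^ i)"
      by simp
    moreover have "v (\<Sum>i\<in>{N<..D}. poly.coeff P i * b ^ i) < 1"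
    proof (rule v_sum_less)
      fix i assume "i \<in> {N<..D}"
      hence "reduction P i = \<zero>\<^bsub>residue_field v\<^esub>"
        using deg_aboveD[OF _ reduction_in_carrier[OF P]] coeff_reduction[OF P] by (simp add: N_def)
      hence "v (poly.coeff P i) < 1" by (simp add: reduction_def residue_zero residue_eq_iff)
      moreover have "v b ^ i \<le> 1" using b by (simp add: power_le_one nonneg)
      ultimately show "v (poly.coeff P i * b ^ i) < 1"
        using nonneg[of "poly.coeff P i"] nonneg[of b] unfolding mult v_power
        by (metis le_less_trans mult_left_le zero_le_power)
    qed simp
    ultimately have "v (poly P b - (\<Sum>i\<le>N. poly.coeff P i * b ^ i)) < 1" by simp
    thus ?thesis by (metis residue_eq_iff)
  qed
  thus ?thesis
    using reduction_in_carrier[OF P] unfolding eval_def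
    by (simp add: coeff_reduction[OF P] summand fin N_def)
qed

text \<open>
  A polynomial over the residue field is determined by its values. The constant coefficient of a
  lift \<open>P\<close> is small, being the value at \<open>0\<close>. If \<open>P\<close> had a unit among its coefficients, its Weierstrass
  degree on the unit disc would be positive, and \<open>P - 1\<close> would have the same Weierstrass degree; so
  \<open>P - 1\<close> would have a zero in the unit disc, where \<open>P\<close> would not be small.
\<close>

lemma reduction_eq_0_of_values:
  assumes P: "integral_poly P" and small: "\<And>b. v b \<le> 1 \<Longrightarrow> v (poly P b) < 1"
  shows "v (poly.coeff P i) < 1"
proof (cases "P = 0")
  case False
  then obtain n where n: "weierstrass_degree v 1 P n" using weierstrass_degree_exists[OF False zero_less_one] by blast
  have "v (poly.coeff P n) < 1"
  proof (rule ccontr)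
    assume "\<not> v (poly.coeff P n) < 1"
    hence one: "v (poly.coeff P n) = 1" using P unfolding integral_poly_def by (metis order.order_iff_strict)
    have c0: "v (poly.coeff P 0) < 1" using small[of 0] by (simp add: poly_0_coeff_0)
    hence "n > 0" using one by (cases n) auto
    have c0': "poly.coeff (P - 1) 0 = poly.coeff P 0 - 1" by simp
    have ci: "poly.coeff (P - 1) j = poly.coeff P j" if "0 < j" for j
      using that by (simp add: one_pCons coeff_pCons split: nat.split)
    have "v (poly.coeff P 0 - 1) \<le> v (poly.coeff P n) * 1 ^ n"
      using v_diff_le[of "poly.coeff P 0" 1] c0 one by simp
    from weierstrass_degree_cong_const[OF n \<open>n > 0\<close> this ci c0']
    have W: "weierstrass_degree v 1 (recentre 0 (P - 1)) n" by simp
    have "poly.coeff (P - 1) n \<noteq> 0" using ci[OF \<open>n > 0\<close>] one by auto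
    hence "P - 1 \<noteq> 0" by auto
    from weierstrass_degree_unique[OF W weierstrass_degree_eq_number_of_roots[OF this]] \<open>n > 0\<close>
    have "0 < size {#b \<in># proots (P - 1). v b \<le> 1#}" by simp
    then obtain b where "b \<in># {#b \<in># proots (P - 1). v b \<le> 1#}"
      using multiset_nonemptyE by (metis nonempty_has_size)
    hence "b \<in># proots (P - 1)" "v b \<le> 1" by simp_all
    with \<open>P - 1 \<noteq> 0\<close> have "poly P b = 1" "v b \<le> 1" by auto
    with small[of b] show False by simp
  qed
  moreover have "v (poly.coeff P i) \<le> v (poly.coeff P n)"
    using n by (simp add: weierstrass_degree_def)
  ultimately show ?thesis by linarith
qed simp

lemma reduction_eqI:
  assumes "integral_poly P" "integral_poly Q"
    and "\<And>b. v b \<le> 1 \<Longrightarrow> residue v (poly P b) = residue v (poly Q b)"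
  shows "reduction P = reduction Q"
proof -
  have int: "integral_poly (P - Q)"
    using assms(1,2) v_diff_le unfolding integral_poly_def by (simp, meson max.boundedI order_trans)
  have "v (poly (P - Q) b) < 1" if "v b \<le> 1" for b
    using assms(3)[OF that] by (simp add: residue_eq_iff)
  from reduction_eq_0_of_values[OF int this]
  show ?thesis unfolding reduction_def by (intro ext) (simp add: residue_eq_iff)
qed

lemma deg_reduction:
  assumes W: "weierstrass_degree v 1 P n" and n: "v (poly.coeff P n) = 1"
  shows "deg (residue_field v) (reduction P) = n"
proof -
  interpret S: cring "residue_field v" by (rule cring_residue_field)
  interpret UP_cring "residue_field v" "UP (residue_field v)" by unfold_locales simp_all
  have P: "integral_poly P" using W n by (simp add: integral_poly_def weierstrass_degree_def)
  show ?thesis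
  proof (rule antisym)
    show "deg (residue_field v) (reduction P) \<le> n"
      by (rule deg_aboveI[OF _ reduction_in_carrier[OF P]])
        (use W n in \<open>simp add: coeff_reduction[OF P], simp add: reduction_def residue_zero residue_eq_iff weierstrass_degree_def\<close>)
    show "n \<le> deg (residue_field v) (reduction P)"
      by (rule deg_belowI[OF _ reduction_in_carrier[OF P]])
        (use n in \<open>simp add: coeff_reduction[OF P], simp add: reduction_def residue_zero residue_eq_iff\<close>)
  qed
qed

end

section \<open>The degree on tangent directions\<close>

lemma coeff_recentre_diff_const:
  "0 < i \<Longrightarrow> poly.coeff (recentre a (f - [:b:])) i = poly.coeff (recentre a f) i"
  by (simp add: pcompose_diff coeff_pCons split: nat.split)

context complete_nonarch_field
begin

lemma weierstrass_degree_change_centre: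
  assumes W: "weierstrass_degree v r (recentre a p) n" and r: "0 < r" and "v (a - b) \<le> r"
  shows "weierstrass_degree v r (recentre b p) n"
proof -
  have "p \<noteq> 0" using weierstrass_degree_pos[OF W r] by auto
  have "v (t - a) \<le> r \<longleftrightarrow> v (t - b) \<le> r" for t
    using ultrametric[of "t - a" "a - b"] v_diff_le[of "t - b" "a - b"] assms(3) by auto
  with weierstrass_degree_unique[OF W weierstrass_degree_eq_number_of_roots[OF \<open>p \<noteq> 0\<close> r]]
    weierstrass_degree_eq_number_of_roots[OF \<open>p \<noteq> 0\<close> r, of b]
  show ?thesis by simp
qed

text \<open>
  The direction is defined through a choice of \<open>b\<close>. Any two choices are close to the same point \<open>y\<close>,
  hence to each other, so that the residue is independent of the choice.
\<close>

lemma direction_eqI: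
  assumes y: "multiplicative_seminorm v y" and c: "c \<noteq> 0"
    and b: "v b \<le> 1" "y [:- (a + c * b), 1:] < v c"
  shows "direction v a c (Seminorm y) = Some (residue v b)"
proof -
  define b' where "b' = (SOME b. v b \<le> 1 \<and> y [:- (a + c * b), 1:] < v c)"
  have ex: "\<exists>b. v b \<le> 1 \<and> y [:- (a + c * b), 1:] < v c" using b by blast
  have "y [:- (a + c * b'), 1:] < v c"
    using someI_ex[OF ex] by (simp add: b'_def)
  moreover have "[:c * (b' - b):] = [:- (a + c * b), 1:] - [:- (a + c * b'), 1:]"
    by (simp add: algebra_simps)
  hence "v (c * (b' - b)) \<le> max (y [:- (a + c * b), 1:]) (y [:- (a + c * b'), 1:])"
    using seminorm_ultrametric_diff[OF y] seminorm_const[OF y] by metis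
  ultimately have "v c * v (b' - b) < v c * 1" using b(2) by (simp add: mult)
  hence "v (b' - b) < 1" using c by (metis mult_less_cancel_left_pos v_pos_iff)
  hence "residue v b' = residue v b" by (simp add: residue_eq_iff)
  thus ?thesis using ex by (simp add: direction_def b'_def)
qed

lemma directionD:
  assumes "direction v a c \<eta> = Some u"
  obtains y b where "\<eta> = Seminorm y" "v b \<le> 1" "y [:- (a + c * b), 1:] < v c" "u = residue v b"
proof (cases \<eta>)
  case Infinity
  thus ?thesis using assms by (simp add: direction_def)
next
  case (Seminorm y)
  with assms have ex: "\<exists>b. v b \<le> 1 \<and> y [:- (a + c * b), 1:] < v c"
    and u: "u = residue v (SOME b. v b \<le> 1 \<and> y [:- (a + c * b), 1:] < v c)"
    by (auto simp: direction_def split: if_splits)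
  from that[OF Seminorm _ _ u] someI_ex[OF ex] show ?thesis by blast
qed

text \<open>
  A point strictly inside the disc is mapped strictly inside the image disc: \<open>f - f t\<close> is divisible by
  \<open>z - t\<close>, and on this factor the inequality is strict while the cofactor is bounded by its disc
  seminorm.
\<close>

lemma seminorm_image_less:
  assumes y: "multiplicative_seminorm v y" and r: "y [:- t, 1:] < r" and f: "0 < Polynomial.degree f"
  shows "y (f - [:poly f t:]) < disc_seminorm v t r (f - [:poly f t:])"
proof -
  have "0 < r" using r seminorm_nonneg[OF y, of "[:- t, 1:]"] by linarith
  note ms = multiplicative_seminorm_disc[OF this, of t]
  have "poly (f - [:poly f t:]) t = 0" by simp
  then obtain h where h: "f - [:poly f t:] = [:- t, 1:] * h"
    using poly_eq_0_iff_dvd by blast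
  have "f \<noteq> [:poly f t:]" using f degree_pCons_0[of "poly f t"] by force
  hence "h \<noteq> 0" using h by auto
  hence "0 < disc_seminorm v t r h" using \<open>0 < r\<close> disc_seminorm_pos by blast
  moreover have "y h \<le> disc_seminorm v t r h" using seminorm_le_disc[OF y] r by simp
  ultimately have "y [:- t, 1:] * y h < r * disc_seminorm v t r h"
    using r seminorm_nonneg[OF y, of "[:- t, 1:]"] seminorm_nonneg[OF y, of h]
    by (meson mult_less_le_imp_less mult_left_mono mult_strict_right_mono le_less_trans)
  also have "\<dots> = disc_seminorm v t r (f - [:poly f t:])"
    unfolding h seminorm_mult[OF ms] using \<open>0 < r\<close> by (simp add: disc_seminorm_linear)
  finally show ?thesis unfolding h seminorm_mult[OF y] .
qed

text \<open>
  This is \<open>f\<close> read in the coordinates \<open>(z - a) / c\<close> at the source and \<open>(z - b) / e\<close> at the target.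
\<close>

definition in_coordinates :: "'a poly \<Rightarrow> 'a \<times> 'a \<Rightarrow> 'a \<times> 'a \<Rightarrow> 'a poly" where
  "in_coordinates f = (\<lambda>(a, c) (b, e). Polynomial.smult (1 / e) (pcompose f [:a, c:] - [:b:]))"

lemma coeff_in_coordinates:
  "poly.coeff (in_coordinates f (a, c) (b, e)) i = poly.coeff (recentre a (f - [:b:])) i * c ^ i / e"
proof -
  have "pcompose f [:a, c:] - [:b:] = pcompose (recentre a (f - [:b:])) [:0, c:]"
    by (simp add: pcompose_pCons pcompose_diff flip: pcompose_assoc)
  thus ?thesis
    by (simp add: in_coordinates_def coeff_pcompose_linear mult.commute)
qed

lemma poly_in_coordinates:
  "e \<noteq> 0 \<Longrightarrow> b + e * poly (in_coordinates f (a, c) (b, e)) t = poly f (a + c * t)"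
  by (simp add: in_coordinates_def poly_pcompose mult.commute)

context
  fixes f :: "'a poly" and a c b e :: 'a
  assumes f: "0 < Polynomial.degree f" and c: "c \<noteq> 0" and e: "e \<noteq> 0"
    and image: "pushforward f (disc_seminorm v a (v c)) = disc_seminorm v b (v e)"
begin

lemma norm_in_coordinates: "disc_seminorm v a (v c) (f - [:b:]) = v e"
  using fun_cong[OF image, of "[:- b, 1:]"] e
  by (simp add: pushforward_linear disc_seminorm_linear nonneg)

lemma weierstrass_degree_in_coordinates:
  assumes "weierstrass_degree v (v c) (recentre a (f - [:b:])) n"
  shows "weierstrass_degree v 1 (in_coordinates f (a, c) (b, e)) n"
    and "v (poly.coeff (in_coordinates f (a, c) (b, e)) n) = 1"
proof -
  have "v e = v (poly.coeff (recentre a (f - [:b:])) n) * v c ^ n"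
    using disc_seminorm_eq[OF assms] c norm_in_coordinates by simp
  thus one: "v (poly.coeff (in_coordinates f (a, c) (b, e)) n) = 1"
    using e unfolding coeff_in_coordinates by (simp add: mult flip: v_eq_0)
  show "weierstrass_degree v 1 (in_coordinates f (a, c) (b, e)) n"
    using assms e unfolding weierstrass_degree_def coeff_in_coordinates
    by (simp add: mult divide_right_mono divide_strict_right_mono nonneg)
qed

lemma integral_in_coordinates: "integral_poly (in_coordinates f (a, c) (b, e))"
proof -
  have "0 < disc_seminorm v a (v c) (f - [:b:])" using norm_in_coordinates e by simp
  hence "recentre a (f - [:b:]) \<noteq> 0" by (auto simp: pcompose_eq_0_iff)
  then obtain n where "weierstrass_degree v (v c) (recentre a (f - [:b:])) n"
    using weierstrass_degree_exists c by (metis v_pos_iff)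
  from weierstrass_degree_in_coordinates[OF this]
  show ?thesis by (simp add: integral_poly_def weierstrass_degree_def)
qed

text \<open>
  The residue disc of \<open>t\<close> is the open disc of radius \<open>v c\<close> about \<open>s = a + c * t\<close>, and it goes into
  the open disc of radius \<open>v e\<close> about \<open>f s\<close>. So the direction of the image depends only on the direction
  of the argument, and it is computed by the coordinate polynomial.
\<close>

lemma direction_image:
  assumes y: "multiplicative_seminorm v y" and t: "v t \<le> 1" and less: "y [:- (a + c * t), 1:] < v c"
  shows "direction v b e (act f (Seminorm y)) =
    Some (residue v (poly (in_coordinates f (a, c) (b, e)) t))"
proof -
  define s where "s = a + c * t"
  have "v c * v t \<le> v c" using t nonneg by (simp add: mult_left_le)
  hence same: "disc_seminorm v a (v c) = disc_seminorm v s (v c)"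
    using c by (simp add: disc_seminorm_eq_iff s_def mult)
  have "f \<noteq> [:poly f s:]" using f degree_pCons_0[of "poly f s"] by force
  hence pos: "0 < disc_seminorm v s (v c) (f - [:poly f s:])"
    using c by (intro disc_seminorm_pos) auto
  have "disc_seminorm v s (v c) (f - [:poly f s:]) = v e"
    using pushforward_disc[of "v c" f s] image same c e f pos by (simp add: disc_seminorm_eq_iff)
  hence "y (f - [:poly f s:]) < v e"
    using seminorm_image_less[OF y _ f, of s "v c"] less by (simp add: s_def)
  hence "pushforward f y [:- (b + e * poly (in_coordinates f (a, c) (b, e)) t), 1:] < v e"
    unfolding pushforward_linear poly_in_coordinates[OF e] s_def .
  thus ?thesis
    unfolding act.simps
    by (intro direction_eqI multiplicative_seminorm_pushforward y e integral_poly_eval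
        integral_in_coordinates t)
qed

text \<open>
  Uniqueness needs only the classical points, which meet every direction other than that
  of \<open>\<infinity>\<close>: a polynomial over the residue field is determined by its values.
\<close>

lemma induces_on_directions_iff:
  "induces_on_directions v f (a, c) (b, e) p \<longleftrightarrow> p = reduction (in_coordinates f (a, c) (b, e))"
proof
  assume "p = reduction (in_coordinates f (a, c) (b, e))"
  moreover have "direction v b e (act f \<eta>) =
      Some (eval (residue_field v) (residue_field v) id u (reduction (in_coordinates f (a, c) (b, e))))"
    if \<eta>: "\<eta> \<in> berkovich_P1 v" and dir: "direction v a c \<eta> = Some u" for \<eta> u
  proof -
    from dir obtain y t where yt: "\<eta> = Seminorm y" "v t \<le> 1" "y [:- (a + c * t), 1:] < v c" "u = residue v t"
      by (rule directionD)
    have "multiplicative_seminorm v y" using \<eta> yt(1) by (auto simp: berkovich_P1_def)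
    from direction_image[OF this yt(2,3)] show ?thesis
      unfolding yt(1,4) eval_reduction[OF integral_in_coordinates yt(2)] .
  qed
  ultimately show "induces_on_directions v f (a, c) (b, e) p"
    by (auto simp: induces_on_directions_def reduction_in_carrier integral_in_coordinates)
next
  assume ind: "induces_on_directions v f (a, c) (b, e) p"
  then obtain P where P: "integral_poly P" "p = reduction P"
    using reduction_surj by (auto simp: induces_on_directions_def)
  have "residue v (poly P t) = residue v (poly (in_coordinates f (a, c) (b, e)) t)" if t: "v t \<le> 1" for t
  proof -
    define y where "y = evaluation_seminorm v (a + c * t)"
    have y: "multiplicative_seminorm v y" unfolding y_def by (rule multiplicative_seminorm_evaluation)
    have less: "y [:- (a + c * t), 1:] < v c" using c by (simp add: y_def evaluation_seminorm_def)
    have "Seminorm y \<in> berkovich_P1 v" using y by (simp add: berkovich_P1_def)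
    with ind direction_eqI[OF y c t less]
    have "direction v b e (act f (Seminorm y)) =
        Some (eval (residue_field v) (residue_field v) id (residue v t) p)"
      unfolding induces_on_directions_def case_prod_conv by blast
    with direction_image[OF y t less] show ?thesis
      unfolding P(2) eval_reduction[OF P(1) t] by simp
  qed
  from reduction_eqI[OF P(1) integral_in_coordinates this] P(2)
  show "p = reduction (in_coordinates f (a, c) (b, e))" by simp
qed

end

lemma coordinatesE:
  assumes "type_II v x"
  obtains a c where "coordinates v x = (a, c)" "c \<noteq> 0" "x = disc_seminorm v a (v c)"
proof -
  have "\<exists>ac. case ac of (a, c) \<Rightarrow> c \<noteq> 0 \<and> x = disc_seminorm v a (v c)"
    using assms by (auto simp: type_II_def)
  from someI_ex[OF this] that show ?thesis
    unfolding coordinates_def by (auto split: prod.splits)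
qed

text \<open>
  The polynomial induced on directions is the reduction of \<open>f\<close> in coordinates where both discs are
  the unit disc; its degree is the last coefficient that is a unit, which is where the Gauss norm
  of \<open>f - f a\<close> is attained for the last time.
\<close>

theorem type_II_degree_disc:
  assumes "c \<noteq> 0" and W: "weierstrass_degree v (v c) (recentre a (f - [:poly f a:])) n"
  shows "type_II_degree v f (disc_seminorm v a (v c)) = n"
proof -
  define x where "x = disc_seminorm v a (v c)"
  have vc: "0 < v c" using assms(1) by simp
  define s where "s = disc_seminorm v a (v c) (f - [:poly f a:])"
  have s: "s = v (poly.coeff (recentre a (f - [:poly f a:])) n) * v c ^ n"
    unfolding s_def by (rule disc_seminorm_eq[OF W vc])
  have "0 < s" unfolding s by (rule weierstrass_degree_pos[OF W vc])
  have "n \<noteq> 0" using \<open>0 < s\<close> s by (intro notI) simp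
  have f: "0 < Polynomial.degree f"
  proof (rule ccontr)
    assume "\<not> 0 < Polynomial.degree f"
    then obtain k where "f = [:k:]" using degree_eq_zeroE by auto
    with \<open>0 < s\<close> s show False by simp
  qed
  have push: "pushforward f x = disc_seminorm v (poly f a) s"
    unfolding x_def s_def using vc f by (rule pushforward_disc)
  have "type_II v x" unfolding type_II_def x_def using assms(1) by blast
  then obtain a' c' where ac: "coordinates v x = (a', c')" "c' \<noteq> 0" "x = disc_seminorm v a' (v c')"
    by (rule coordinatesE)
  have "s = v (poly.coeff (recentre a (f - [:poly f a:])) n * c ^ n)" unfolding s by (simp add: mult)
  hence "type_II v (pushforward f x)"
    unfolding type_II_def push using \<open>0 < s\<close> by (metis v_pos_iff)
  then obtain b e where be: "coordinates v (pushforward f x) = (b, e)" "e \<noteq> 0"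
      "pushforward f x = disc_seminorm v b (v e)"
    by (rule coordinatesE)
  have c': "v c = v c'" "v (a - a') \<le> v c"
    using ac(3) disc_seminorm_eq_iff[of "v c" "v c'" a a'] vc ac(2) unfolding x_def by auto
  have e: "v (poly f a - b) \<le> s"
    using be(3) push disc_seminorm_eq_iff[of s "v e" "poly f a" b] \<open>0 < s\<close> be(2) by auto
  have "weierstrass_degree v (v c) (recentre a (f - [:b:])) n"
  proof (rule weierstrass_degree_cong_const[OF W])
    show "v (poly f a - b) \<le> v (poly.coeff (recentre a (f - [:poly f a:])) n) * v c ^ n"
      using e unfolding s .
  qed (use \<open>n \<noteq> 0\<close> in \<open>simp_all add: coeff_recentre_diff_const\<close>)
  hence W': "weierstrass_degree v (v c') (recentre a' (f - [:b:])) n"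
    using weierstrass_degree_change_centre vc c' by metis
  have image: "pushforward f (disc_seminorm v a' (v c')) = disc_seminorm v b (v e)"
    using be(3) ac(3) by simp
  have "(THE p. induces_on_directions v f (a', c') (b, e) p) = reduction (in_coordinates f (a', c') (b, e))"
    using induces_on_directions_iff[OF f ac(2) be(2) image] by simp
  moreover have "deg (residue_field v) (reduction (in_coordinates f (a', c') (b, e))) = n"
    using weierstrass_degree_in_coordinates[OF f ac(2) be(2) image W'] by (rule deg_reduction)
  ultimately show ?thesis
    unfolding type_II_degree_def ac(1) be(1) x_def[symmetric] by simp
qed

end

section \<open>Fixed points\<close>

lemma coeff_1_recentre: "poly.coeff (recentre a f) 1 = poly (pderiv f) a"
proof -
  have "poly.coeff (recentre a f) 1 = poly.coeff (pderiv (recentre a f)) 0"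
    by (simp add: coeff_pderiv)
  also have "pderiv (recentre a f) = recentre a (pderiv f)"
    by (simp add: pderiv_pcompose pderiv_pCons)
  finally show ?thesis by simp
qed

lemma order_eq_1:
  fixes p :: "'a::field poly"
  assumes "poly p a = 0" "poly (pderiv p) a \<noteq> 0"
  shows "Polynomial.order a p = 1"
proof -
  have "p \<noteq> 0" using assms(2) by auto
  hence "Polynomial.order a p \<noteq> 0" using assms(1) order_root by blast
  moreover have "\<not> 2 \<le> Polynomial.order a p"
  proof
    assume "2 \<le> Polynomial.order a p"
    hence "[:- a, 1:] ^ 2 dvd p" by (simp add: order_divides)
    then obtain q where "p = [:- a, 1:] ^ 2 * q" by (elim dvdE)
    hence "p = [:- a, 1:] * ([:- a, 1:] * q)" by (simp only: power2_eq_square mult.assoc)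
    hence "poly (pderiv p) a = 0" by (simp only: pderiv_mult poly_add poly_mult) simp
    with assms(2) show False by contradiction
  qed
  ultimately show ?thesis by linarith
qed

context complete_nonarch_field
begin

definition repelling_fixed :: "'a poly \<Rightarrow> ('a poly \<Rightarrow> real) \<Rightarrow> bool" where
  "repelling_fixed f x \<longleftrightarrow> Seminorm x \<in> Fix v f \<and> repelling v f (Seminorm x)"

lemma Seminorm_in_Fix_iff:
  "Seminorm x \<in> Fix v f \<longleftrightarrow> multiplicative_seminorm v x \<and> pushforward f x = x"
  by (auto simp: Fix_def berkovich_P1_def)

lemma repelling_fixed_evaluation_iff:
  "repelling_fixed f (evaluation_seminorm v a) \<longleftrightarrow> poly f a = a \<and> 1 < v (poly (pderiv f) a)"
  by (simp add: repelling_fixed_def Seminorm_in_Fix_iff multiplicative_seminorm_evaluation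
      pushforward_evaluation)

lemma local_degree_disc:
  "c \<noteq> 0 \<Longrightarrow> local_degree v f (Seminorm (disc_seminorm v a (v c))) =
    type_II_degree v f (disc_seminorm v a (v c))"
  by (auto simp: type_II_def)

lemma repelling_fixed_disc_iff:
  assumes "c \<noteq> 0"
  shows "repelling_fixed f (disc_seminorm v a (v c)) \<longleftrightarrow>
    pushforward f (disc_seminorm v a (v c)) = disc_seminorm v a (v c) \<and>
    2 \<le> type_II_degree v f (disc_seminorm v a (v c))"
  using assms local_degree_disc[OF assms]
  by (simp add: repelling_fixed_def Seminorm_in_Fix_iff multiplicative_seminorm_disc del: local_degree.simps)

lemma evaluation_le_disc_iff:
  assumes "0 < r"
  shows "evaluation_seminorm v b \<le> disc_seminorm v a r \<longleftrightarrow> v (b - a) \<le> r"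
proof
  assume "evaluation_seminorm v b \<le> disc_seminorm v a r"
  from le_funD[OF this, of "[:- a, 1:]"] show "v (b - a) \<le> r"
    using assms by (simp add: evaluation_seminorm_def disc_seminorm_linear)
next
  assume "v (b - a) \<le> r"
  hence "evaluation_seminorm v b [:- a, 1:] \<le> r" by (simp add: evaluation_seminorm_def)
  thus "evaluation_seminorm v b \<le> disc_seminorm v a r"
    by (intro le_funI seminorm_le_disc multiplicative_seminorm_evaluation)
qed

lemma evaluation_le_evaluation_iff:
  "evaluation_seminorm v b \<le> evaluation_seminorm v a \<longleftrightarrow> b = a"
proof
  assume "evaluation_seminorm v b \<le> evaluation_seminorm v a"
  from le_funD[OF this, of "[:- a, 1:]"] show "b = a"
    using nonneg[of "b - a"] by (simp add: evaluation_seminorm_def)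
qed simp

text \<open>
  A fixed point does not distinguish \<open>f - a\<close> from \<open>z - a\<close> in size, and \<open>f - z\<close> is their difference.
\<close>

lemma seminorm_fixed_displacement_le:
  assumes x: "multiplicative_seminorm v x" and fixed: "pushforward f x = x"
  shows "x (f - [:0, 1:]) \<le> x [:- a, 1:]"
proof -
  have "f - [:0, 1:] = (f - [:a:]) - [:- a, 1:]" by simp
  moreover have "x (f - [:a:]) = x [:- a, 1:]"
    using fun_cong[OF fixed, of "[:- a, 1:]"] by (simp add: pushforward_linear)
  ultimately show ?thesis using seminorm_ultrametric_diff[OF x] by (metis max.idem)
qed

lemma coeff_recentre_displacement:
  "poly.coeff (recentre a (f - [:0, 1:])) i = poly.coeff (recentre a f) i - poly.coeff [:a, 1:] i"
  by (simp add: pcompose_diff pcompose_pCons)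

section \<open>Fixed points of types III and IV\<close>

lemma type_I_of_zero:
  assumes x: "multiplicative_seminorm v x" and "x [:- a, 1:] = 0"
  shows "x = evaluation_seminorm v a"
proof (rule seminorm_eqI[OF x multiplicative_seminorm_evaluation])
  fix b
  have eq: "[:- b, 1:] = [:- a, 1:] + [:a - b:]" by simp
  show "x [:- b, 1:] = evaluation_seminorm v a [:- b, 1:]"
  proof (cases "a = b")
    case False
    hence "x ([:- a, 1:] + [:a - b:]) = x [:a - b:]"
      using assms by (intro seminorm_eq_of_less) (simp_all add: seminorm_const)
    thus ?thesis unfolding eq using x by (simp add: evaluation_seminorm_def seminorm_const)
  qed (use assms in \<open>simp add: evaluation_seminorm_def\<close>)
qed

text \<open>
  If the distance from \<open>x\<close> to the classical points is attained, at \<open>a\<close>, then \<open>x\<close> is the point of the disc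
  with this radius about \<open>a\<close>: all other distances are forced by the ultrametric inequality, and
  minimality settles the case of equality.
\<close>

lemma eq_disc_of_minimal:
  assumes x: "multiplicative_seminorm v x" and min: "\<And>b. x [:- a, 1:] \<le> x [:- b, 1:]"
    and pos: "0 < x [:- a, 1:]"
  shows "x = disc_seminorm v a (x [:- a, 1:])"
proof (rule seminorm_eqI[OF x multiplicative_seminorm_disc[OF pos]])
  fix b
  have eq: "[:- b, 1:] = [:a - b:] + [:- a, 1:]" by simp
  have "x [:- b, 1:] = max (v (a - b)) (x [:- a, 1:])"
  proof (cases "v (a - b)" "x [:- a, 1:]" rule: linorder_cases)
    case less
    hence "x ([:a - b:] + [:- a, 1:]) = x [:- a, 1:]"
      using x by (intro seminorm_eq_of_less) (simp_all add: seminorm_const)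
    with less show ?thesis unfolding eq by simp
  next
    case equal
    have "x ([:a - b:] + [:- a, 1:]) \<le> max (x [:a - b:]) (x [:- a, 1:])"
      by (rule seminorm_ultrametric[OF x])
    with equal min[of b] show ?thesis unfolding eq by (simp add: seminorm_const[OF x])
  next
    case greater
    hence "x ([:- a, 1:] + [:a - b:]) = x [:a - b:]"
      using x by (intro seminorm_eq_of_less) (simp_all add: seminorm_const)
    with greater show ?thesis unfolding eq by (simp add: add.commute seminorm_const[OF x])
  qed
  thus "x [:- b, 1:] = disc_seminorm v a (x [:- a, 1:]) [:- b, 1:]"
    using pos by (simp add: disc_seminorm_linear)
qed

lemma weierstrass_degree_0_constant_dominates:
  assumes x: "multiplicative_seminorm v x" and W: "weierstrass_degree v (x [:- a, 1:]) (recentre a p) 0"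
    and r: "0 < x [:- a, 1:]"
  shows "x p = v (poly p a)"
proof -
  obtain q where q: "p - [:poly p a:] = [:- a, 1:] * q"
    using poly_eq_0_iff_dvd[of "p - [:poly p a:]" a] by auto
  define r where "r = x [:- a, 1:]"
  have pos: "0 < v (poly p a)" using weierstrass_degree_pos[OF W assms(3)] by simp
  have "disc_seminorm v a r (p - [:poly p a:]) < v (poly p a)"
  proof (cases "p - [:poly p a:] = 0")
    case False
    hence "recentre a (p - [:poly p a:]) \<noteq> 0" by (auto simp: pcompose_eq_0_iff)
    then obtain m where m: "weierstrass_degree v r (recentre a (p - [:poly p a:])) m"
      using weierstrass_degree_exists r r_def by metis
    have "m \<noteq> 0" using weierstrass_degree_pos[OF m] r r_def by (intro notI) simp
    with disc_seminorm_eq[OF m] r W show ?thesis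
      by (auto simp: coeff_recentre_diff_const weierstrass_degree_def r_def)
  qed (use pos in simp)
  moreover have "x (p - [:poly p a:]) \<le> disc_seminorm v a r (p - [:poly p a:])"
    by (rule seminorm_le_disc[OF x]) (simp add: r_def)
  ultimately have "x ((p - [:poly p a:]) + [:poly p a:]) = x [:poly p a:]"
    by (intro seminorm_eq_of_less[OF x]) (simp add: seminorm_const[OF x])
  thus ?thesis by (simp add: seminorm_const[OF x])
qed

text \<open>
  The first case is that of a type III point. Its radius is not a value of \<open>v\<close>, so a term of degree at
  least \<open>2\<close> cannot be as large as the radius, whence the linear term must be. In the second case
  (type IV) a small disc around \<open>x\<close> contains no classical fixed point, so \<open>f - z\<close> has constant size on
  it, and this size is at most the radius because \<open>x\<close> is fixed.
\<close>

lemma fixed_not_type_I_II_expansion: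
  assumes x: "multiplicative_seminorm v x" and fixed: "pushforward f x = x"
    and not_I: "\<not> type_I v x" and not_II: "\<not> type_II v x" and deg: "2 \<le> Polynomial.degree f"
  obtains a where "0 < x [:- a, 1:]" "v (poly.coeff (recentre a f) 1) = 1"
    "\<And>i. 2 \<le> i \<Longrightarrow> v (poly.coeff (recentre a f) i) * x [:- a, 1:] ^ i < x [:- a, 1:]"
proof -
  define g where "g = f - [:0, 1:]"
  have pos: "0 < x [:- a, 1:]" for a
    using type_I_of_zero[OF x, of a] not_I seminorm_nonneg[OF x, of "[:- a, 1:]"]
    by (metis order.order_iff_strict type_I_evaluation)
  have g_le: "x g \<le> x [:- a, 1:]" for a
    unfolding g_def by (rule seminorm_fixed_displacement_le[OF x fixed])
  have coeff_g: "poly.coeff (recentre a g) i = poly.coeff (recentre a f) i" if "2 \<le> i" for a i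
    using that unfolding g_def coeff_recentre_displacement
    by (auto simp: coeff_pCons split: nat.split)
  have coeff_g1: "poly.coeff (recentre a f) 1 = poly.coeff (recentre a g) 1 + 1" for a
    unfolding g_def coeff_recentre_displacement by simp
  have "Polynomial.degree [:0, 1::'a:] < Polynomial.degree f" using deg by simp
  hence "Polynomial.degree g = Polynomial.degree f"
    unfolding g_def by (metis degree_add_eq_left degree_minus diff_conv_add_uminus)
  hence "g \<noteq> 0" using deg by auto
  show ?thesis
  proof (cases "\<exists>a. \<forall>b. x [:- a, 1:] \<le> x [:- b, 1:]")
    case True
    then obtain a where min: "\<And>b. x [:- a, 1:] \<le> x [:- b, 1:]" by blast
    define r where "r = x [:- a, 1:]"
    have r: "0 < r" unfolding r_def by (rule pos)
    have disc: "x = disc_seminorm v a r"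
      unfolding r_def by (rule eq_disc_of_minimal[OF x min pos])
    have not_value: "v u \<noteq> r" for u
      using not_II disc r unfolding type_II_def by (metis v_pos_iff)
    have g_term: "v (poly.coeff (recentre a g) i) * r ^ i \<le> r" for i
      using coeff_le_disc_seminorm[of r g a i] g_le[of a] r disc unfolding r_def by simp
    have high: "v (poly.coeff (recentre a f) i) * r ^ i < r" if i: "2 \<le> i" for i
    proof (rule ccontr)
      assume "\<not> ?thesis"
      with g_term[of i] coeff_g[OF i] have eq: "v (poly.coeff (recentre a f) i) * r ^ i = r" by simp
      define k where "k = poly.coeff (recentre a f) i"
      have "k \<noteq> 0" using eq r by (auto simp: k_def)
      \<comment> \<open>Equality would make \<open>r\<close> a value of \<open>v\<close>, since the value group is divisible.\<close>
      obtain u where u: "u ^ (i - 1) = 1 / k" using nth_root_exists[of "i - 1"] i by auto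
      have "r ^ i = r ^ (i - 1) * r" using i by (metis Suc_diff_1 less_le_trans pos2 power_Suc2)
      hence "v k * r ^ (i - 1) = 1" using eq r by (simp add: k_def)
      moreover have "v u ^ (i - 1) = 1 / v k" using u by (metis v_1 v_divide v_power)
      ultimately have "v k * r ^ (i - 1) = v k * v u ^ (i - 1)"
        using \<open>k \<noteq> 0\<close> by simp
      hence "r ^ (i - 1) = v u ^ (i - 1)" using \<open>k \<noteq> 0\<close> by simp
      hence "r = v u" using i r nonneg by (intro power_eq_imp_eq_base[of r "i - 1" "v u"]) auto
      thus False using not_value[of u] by simp
    qed
    have "v (poly.coeff (recentre a g) 1) \<le> 1" using g_term[of 1] r by simp
    hence le1: "v (poly.coeff (recentre a f) 1) \<le> 1"
      unfolding coeff_g1 using ultrametric[of "poly.coeff (recentre a g) 1" 1] by simp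
    have "v (poly.coeff (recentre a f) 1) = 1"
    proof (rule ccontr)
      assume "v (poly.coeff (recentre a f) 1) \<noteq> 1"
      with le1 r have low: "v (poly.coeff (recentre a f) 1) * r ^ 1 < r" by simp
      have "f \<noteq> [:poly f a:]" using deg degree_pCons_0[of "poly f a"] by force
      hence "recentre a (f - [:poly f a:]) \<noteq> 0" by (auto simp: pcompose_eq_0_iff)
      then obtain m where m: "weierstrass_degree v r (recentre a (f - [:poly f a:])) m"
        using weierstrass_degree_exists r by metis
      have "m \<noteq> 0" using weierstrass_degree_pos[OF m r] by (intro notI) simp
      hence "x (f - [:poly f a:]) = v (poly.coeff (recentre a f) m) * r ^ m"
        using disc_seminorm_eq[OF m r] disc by (simp add: coeff_recentre_diff_const)
      also have "\<dots> < r"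
        using low high[of m] \<open>m \<noteq> 0\<close> by (cases "m = 1") auto
      \<comment> \<open>The image disc would be smaller than the smallest disc around \<open>x\<close>.\<close>
      also have "\<dots> \<le> x [:- poly f a, 1:]" unfolding r_def by (rule min)
      also have "\<dots> = x (f - [:poly f a:])"
        using fun_cong[OF fixed, of "[:- poly f a, 1:]"] by (simp add: pushforward_linear)
      finally show False by simp
    qed
    with that[of a] high r show ?thesis unfolding r_def by blast
  next
    case False
    have closer: "\<exists>b. x [:- b, 1:] < x [:- a, 1:]" for a using False not_le by blast
    have "finite S \<Longrightarrow> \<exists>a. \<forall>t\<in>S. x [:- a, 1:] < x [:- t, 1:]" for S
    proof (induction S rule: finite_induct)
      case (insert t S)
      then obtain a where a: "\<forall>t\<in>S. x [:- a, 1:] < x [:- t, 1:]" by blast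
      obtain b where b: "x [:- b, 1:] < x [:- t, 1:]" using closer by blast
      show ?case
      proof (cases "x [:- a, 1:] \<le> x [:- b, 1:]")
        case True
        with a b have "\<forall>u\<in>insert t S. x [:- a, 1:] < x [:- u, 1:]" by (blast intro: le_less_trans)
        thus ?thesis by blast
      next
        case False
        hence "x [:- b, 1:] < x [:- a, 1:]" by simp
        with a b have "\<forall>u\<in>insert t S. x [:- b, 1:] < x [:- u, 1:]" by (blast intro: less_trans)
        thus ?thesis by blast
      qed
    qed simp
    from this[of "set_mset (proots g)"]
    obtain a where a: "\<And>t. t \<in># proots g \<Longrightarrow> x [:- a, 1:] < x [:- t, 1:]" by blast
    define r where "r = x [:- a, 1:]"
    have r: "0 < r" unfolding r_def by (rule pos)
    have "\<not> v (t - a) \<le> r" if "t \<in># proots g" for t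
    proof -
      have "[:- t, 1:] = [:- a, 1:] - [:t - a:]" by simp
      hence "x [:- t, 1:] \<le> max r (v (t - a))"
        using seminorm_ultrametric_diff[OF x] seminorm_const[OF x] unfolding r_def by metis
      thus ?thesis using a[OF that] unfolding r_def by linarith
    qed
    hence "{#t \<in># proots g. v (t - a) \<le> r#} = {#}" unfolding filter_mset_eq_mempty_iff by blast
    with weierstrass_degree_eq_number_of_roots[OF \<open>g \<noteq> 0\<close> r, of a]
    have W: "weierstrass_degree v r (recentre a g) 0" by simp
    from weierstrass_degree_0_constant_dominates[OF x] W pos have "x g = v (poly g a)"
      unfolding r_def by blast
    hence "v (poly g a) \<le> r" using g_le[of a] by (simp add: r_def)
    moreover have "v (poly.coeff (recentre a g) i) * r ^ i < v (poly g a)" if "0 < i" for i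
      using W that by (simp add: weierstrass_degree_def)
    ultimately have small: "v (poly.coeff (recentre a g) i) * r ^ i < r" if "0 < i" for i
      using that by (meson less_le_trans)
    have "v (poly.coeff (recentre a g) 1) < 1" using small[of 1] r by simp
    hence "v (poly.coeff (recentre a f) 1) = 1"
      unfolding coeff_g1 using v_add_eq_right[of _ 1] by simp
    moreover have "v (poly.coeff (recentre a f) i) * r ^ i < r" if "2 \<le> i" for i
      using small[of i] coeff_g[OF that] that by simp
    ultimately show ?thesis using that[of a] r unfolding r_def by blast
  qed
qed

text \<open>
  The strict inequalities in the expansion persist on a slightly larger disc, and its radius can be
  taken in the value group. This gives a type II point above \<open>x\<close> with local degree \<open>1\<close>.
\<close>

lemma local_degree_fixed_not_type_I_II:
  assumes x: "multiplicative_seminorm v x" and fixed: "pushforward f x = x"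
    and not_I: "\<not> type_I v x" and not_II: "\<not> type_II v x" and deg: "2 \<le> Polynomial.degree f"
  shows "local_degree v f (Seminorm x) \<le> 1"
proof -
  obtain a where r: "0 < x [:- a, 1:]" and c1: "v (poly.coeff (recentre a f) 1) = 1"
    and high: "\<And>i. 2 \<le> i \<Longrightarrow> v (poly.coeff (recentre a f) i) * x [:- a, 1:] ^ i < x [:- a, 1:]"
    by (rule fixed_not_type_I_II_expansion[OF assms]) (blast intro: that)
  define r where "r = x [:- a, 1:]"
  let ?P = "\<lambda>i R. v (poly.coeff (recentre a f) i) * R ^ i < R"
  have "eventually (\<lambda>R. \<forall>i\<in>{2..Polynomial.degree f}. ?P i R) (at_right r)"
  proof (rule eventually_ball_finite)
    show "\<forall>i\<in>{2..Polynomial.degree f}. eventually (?P i) (at_right r)"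
    proof
      fix i assume "i \<in> {2..Polynomial.degree f}"
      have "((\<lambda>R. R - v (poly.coeff (recentre a f) i) * R ^ i) \<longlongrightarrow>
          r - v (poly.coeff (recentre a f) i) * r ^ i) (at_right r)"
        by (intro tendsto_intros)
      moreover have "0 < r - v (poly.coeff (recentre a f) i) * r ^ i"
        using high[of i] \<open>i \<in> _\<close> by (simp add: r_def)
      ultimately have "eventually (\<lambda>R. 0 < R - v (poly.coeff (recentre a f) i) * R ^ i) (at_right r)"
        by (rule order_tendstoD)
      thus "eventually (?P i) (at_right r)" by simp
    qed
  qed simp
  then obtain R where "r < R" and R: "\<And>y. r < y \<Longrightarrow> y < R \<Longrightarrow> \<forall>i\<in>{2..Polynomial.degree f}. ?P i y"
    unfolding eventually_at_right_field by blast
  obtain c where c: "c \<noteq> 0" "r < v c" "v c < R"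
    using value_group_dense \<open>r < R\<close> r unfolding r_def by metis
  have high': "?P i (v c)" if "2 \<le> i" for i
  proof (cases "i \<le> Polynomial.degree f")
    case False
    thus ?thesis using c(1) by (simp add: coeff_eq_0)
  qed (use R[OF c(2,3)] that in simp)
  have "weierstrass_degree v (v c) (recentre a (f - [:poly f a:])) 1"
    unfolding weierstrass_degree_def
  proof (intro conjI allI impI)
    fix i :: nat
    have top: "v (poly.coeff (recentre a (f - [:poly f a:])) 1) * v c ^ 1 = v c"
      using c1 by (simp add: coeff_recentre_diff_const)
    consider "i = 0" | "i = 1" | "2 \<le> i" by linarith
    thus "v (poly.coeff (recentre a (f - [:poly f a:])) i) * v c ^ i
        \<le> v (poly.coeff (recentre a (f - [:poly f a:])) 1) * v c ^ 1"
      unfolding top using high'[of i] c1 nonneg by cases (auto simp: coeff_recentre_diff_const)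
    show "v (poly.coeff (recentre a (f - [:poly f a:])) i) * v c ^ i
        < v (poly.coeff (recentre a (f - [:poly f a:])) 1) * v c ^ 1" if "1 < i"
      unfolding top using high'[of i] that by (auto simp: coeff_recentre_diff_const)
  qed
  hence "type_II_degree v f (disc_seminorm v a (v c)) = 1"
    using c(1) by (intro type_II_degree_disc)
  moreover have "x \<le> disc_seminorm v a (v c)"
    using c(2) by (intro le_funI seminorm_le_disc[OF x]) (simp add: r_def)
  moreover have "type_II v (disc_seminorm v a (v c))" using c(1) by (auto simp: type_II_def)
  ultimately have "(LEAST n. \<exists>y. type_II v y \<and> x \<le> y \<and> n = type_II_degree v f y) \<le> 1"
    by (intro Least_le) metis
  thus ?thesis using not_I not_II by simp
qed

end

section \<open>Repelling fixed points and zeros of \<open>f - z\<close>\<close>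

locale polynomial_dynamics = complete_nonarch_field +
  fixes f :: "'a poly"
  assumes degree_ge_2: "2 \<le> Polynomial.degree f"
begin

abbreviation displacement :: "'a poly" where
  "displacement \<equiv> f - [:0, 1:]"

lemma degree_displacement: "Polynomial.degree displacement = Polynomial.degree f"
  and displacement_nonzero: "displacement \<noteq> 0"
proof -
  have "Polynomial.degree [:0, 1::'a:] < Polynomial.degree f" using degree_ge_2 by simp
  thus "Polynomial.degree displacement = Polynomial.degree f"
    by (metis degree_add_eq_left degree_minus diff_conv_add_uminus)
  thus "displacement \<noteq> 0" using degree_ge_2 by auto
qed

lemma f_minus_const_nonzero: "f - [:b:] \<noteq> 0"
proof -
  have "f \<noteq> [:b:]" using degree_ge_2 degree_pCons_0[of b] by force
  thus ?thesis by simp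
qed

lemma type_II_weierstrass_degree:
  assumes "c \<noteq> 0"
  shows "weierstrass_degree v (v c) (recentre a (f - [:poly f a:]))
    (type_II_degree v f (disc_seminorm v a (v c)))"
proof -
  have "recentre a (f - [:poly f a:]) \<noteq> 0"
    using f_minus_const_nonzero by (auto simp: pcompose_eq_0_iff)
  then obtain n where "weierstrass_degree v (v c) (recentre a (f - [:poly f a:])) n"
    using weierstrass_degree_exists assms by (metis v_pos_iff)
  thus ?thesis using type_II_degree_disc[OF assms] by metis
qed

lemma disc_fixed_iff:
  assumes "0 < r"
  shows "pushforward f (disc_seminorm v a r) = disc_seminorm v a r \<longleftrightarrow>
    disc_seminorm v a r (f - [:poly f a:]) = r \<and> v (poly f a - a) \<le> r"
  using pushforward_disc[OF assms, of f a] degree_ge_2 assms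
    disc_seminorm_eq_iff[OF disc_seminorm_pos[OF assms f_minus_const_nonzero] assms] by auto

lemma repelling_fixed_cases:
  assumes "repelling_fixed f x"
  obtains a where "x = evaluation_seminorm v a" "poly f a = a" "1 < v (poly (pderiv f) a)"
  | a c where "c \<noteq> 0" "x = disc_seminorm v a (v c)" "pushforward f x = x" "2 \<le> type_II_degree v f x"
proof -
  have x: "multiplicative_seminorm v x" "pushforward f x = x"
    using assms by (auto simp: repelling_fixed_def Seminorm_in_Fix_iff)
  consider "type_I v x" | "type_II v x" | "\<not> type_I v x" "\<not> type_II v x" by blast
  thus ?thesis
  proof cases
    case 1
    thus ?thesis using that(1) assms by (auto simp: type_I_def repelling_fixed_evaluation_iff)
  next
    case 2
    thus ?thesis using that(2) assms by (auto simp: type_II_def repelling_fixed_disc_iff)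
  next
    case 3
    hence "local_degree v f (Seminorm x) \<le> 1"
      using local_degree_fixed_not_type_I_II x degree_ge_2 by blast
    moreover have "2 \<le> local_degree v f (Seminorm x)"
      using assms 3(1) by (simp add: repelling_fixed_def del: local_degree.simps)
    ultimately show ?thesis by simp
  qed
qed

text \<open>
  On a fixed disc of local degree \<open>n \<ge> 2\<close> the Taylor expansions of \<open>f - f a\<close> and \<open>f - z\<close> differ only in
  the terms of degree \<open>0\<close> and \<open>1\<close>, and by no more than the Gauss norm, so \<open>f - z\<close> has Weierstrass
  degree \<open>n\<close>, too.
\<close>

lemma local_degree_eq_number_of_fixed_points:
  assumes "repelling_fixed f x"
  shows "local_degree v f (Seminorm x) = size {#b \<in># proots displacement. evaluation_seminorm v b \<le> x#}"
  using assms
proof (cases rule: repelling_fixed_cases)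
  case (1 a)
  have "pderiv displacement = pderiv f - 1" by (simp add: pderiv_diff pderiv_pCons one_pCons)
  moreover have "poly (pderiv f) a \<noteq> 1" "poly (pderiv f) a \<noteq> 0" using 1(3) by auto
  ultimately have "Polynomial.order a displacement = 1" "Polynomial.order a (f - [:poly f a:]) = 1"
    using 1(2) order_eq_1[of displacement a] order_eq_1[of "f - [:poly f a:]" a]
    by (simp_all add: pderiv_diff pderiv_pCons)
  moreover have "{#b \<in># proots displacement. evaluation_seminorm v b \<le> x#} =
      replicate_mset (Polynomial.order a displacement) a"
    by (rule multiset_eqI) (simp add: count_proots[OF displacement_nonzero] 1(1) evaluation_le_evaluation_iff)
  ultimately show ?thesis using 1(1) by (simp add: Let_def)
next
  case (2 a c)
  define r where "r = v c"
  have r: "0 < r" using 2(1) by (simp add: r_def)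
  define n where "n = type_II_degree v f x"
  have n: "2 \<le> n" using 2(4) by (simp add: n_def)
  have W: "weierstrass_degree v r (recentre a (f - [:poly f a:])) n"
    unfolding n_def 2(2) r_def using type_II_weierstrass_degree 2(1) by blast
  have "disc_seminorm v a r (f - [:poly f a:]) = r" and c0: "v (poly f a - a) \<le> r"
    using 2(2,3) disc_fixed_iff[OF r] unfolding r_def by auto
  with disc_seminorm_eq[OF W r] have top: "v (poly.coeff (recentre a (f - [:poly f a:])) n) * r ^ n = r"
    by simp
  have coeff: "poly.coeff (recentre a displacement) i = poly.coeff (recentre a (f - [:poly f a:])) i"
    if "2 \<le> i" for i
    using that unfolding coeff_recentre_displacement
    by (auto simp: coeff_recentre_diff_const coeff_pCons split: nat.split)
  have "weierstrass_degree v r (recentre a displacement) n"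
    unfolding weierstrass_degree_def coeff[OF n] top
  proof (intro conjI allI impI)
    fix i :: nat
    have le: "v (poly.coeff (recentre a (f - [:poly f a:])) j) * r ^ j \<le> r" for j
      using W unfolding weierstrass_degree_def top by blast
    have "v (poly.coeff (recentre a (f - [:poly f a:])) 1) \<le> 1" using le[of 1] r by simp
    hence "v (poly.coeff (recentre a displacement) 1) \<le> 1"
      unfolding coeff_recentre_displacement
      using v_diff_le[of "poly.coeff (recentre a f) 1" 1] by (simp add: coeff_recentre_diff_const)
    hence "v (poly.coeff (recentre a displacement) 1) * r ^ 1 \<le> r" using r by simp
    moreover have "v (poly.coeff (recentre a displacement) 0) * r ^ 0 \<le> r" using c0 by simp
    moreover have "v (poly.coeff (recentre a displacement) i) * r ^ i \<le> r" if "2 \<le> i"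
      unfolding coeff[OF that] by (rule le)
    moreover consider "i = 0" | "i = 1" | "2 \<le> i" by linarith
    ultimately show "v (poly.coeff (recentre a displacement) i) * r ^ i \<le> r" by metis
    show "v (poly.coeff (recentre a displacement) i) * r ^ i < r" if "n < i"
      using W that n coeff[of i] unfolding weierstrass_degree_def top by simp
  qed
  hence "n = size {#b \<in># proots displacement. v (b - a) \<le> r#}"
    using weierstrass_degree_unique weierstrass_degree_eq_number_of_roots[OF displacement_nonzero r] by blast
  also have "(\<lambda>b. v (b - a) \<le> r) = (\<lambda>b. evaluation_seminorm v b \<le> x)"
    unfolding 2(2) using r by (simp add: evaluation_le_disc_iff r_def)
  finally show ?thesis
    unfolding n_def 2(2) local_degree_disc[OF 2(1)] .
qed

text \<open>
  Expand \<open>f\<close> at a fixed point \<open>b\<close> and let \<open>s(r)\<close> be the radius of the image of the disc of radius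
  \<open>r\<close> about \<open>b\<close>. If the multiplier is not repelling then \<open>s(r) \<le> r\<close> for small \<open>r\<close>, and the
  largest radius with \<open>s(r) \<le> r\<close> is where a term of degree at least \<open>2\<close> reaches \<open>r\<close>.
\<close>

lemma repelling_fixed_above_fixed_point:
  assumes b: "poly f b = b"
  shows "\<exists>x. repelling_fixed f x \<and> evaluation_seminorm v b \<le> x"
proof (cases "1 < v (poly (pderiv f) b)")
  case True
  with b have "repelling_fixed f (evaluation_seminorm v b)" by (simp add: repelling_fixed_evaluation_iff)
  thus ?thesis by blast
next
  case False
  define k where "k i = poly.coeff (recentre b f) i" for i
  define I where "I = {i \<in> {2..Polynomial.degree f}. k i \<noteq> 0}"
  have k1: "v (k 1) \<le> 1" using False by (simp only: k_def coeff_1_recentre not_less)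
  have "f \<noteq> 0" using degree_ge_2 by auto
  hence "poly.coeff (recentre b f) (Polynomial.degree f) \<noteq> 0"
    using leading_coeff_0_iff[of "recentre b f"] unfolding degree_recentre
    by (simp add: pcompose_eq_0_iff)
  hence "Polynomial.degree f \<in> I" using degree_ge_2 by (simp add: I_def k_def)
  \<comment> \<open>The term of degree \<open>i\<close> has size equal to the radius exactly at the radius \<open>v (\<rho> i)\<close>. As this is
    a value of \<open>v\<close>, the disc that is found has type II.\<close>
  have "\<exists>u. u ^ (i - 1) = 1 / k i" if "i \<in> I" for i
    using that by (intro nth_root_exists) (auto simp: I_def)
  then obtain \<rho> where \<rho>: "\<And>i. i \<in> I \<Longrightarrow> \<rho> i ^ (i - 1) = 1 / k i" by metis
  have "finite I" "I \<noteq> {}" using \<open>Polynomial.degree f \<in> I\<close> by (auto simp: I_def)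
  define m where "m = arg_min_on (\<lambda>i. v (\<rho> i)) I"
  have m: "m \<in> I" "\<And>i. i \<in> I \<Longrightarrow> v (\<rho> m) \<le> v (\<rho> i)"
    unfolding m_def using \<open>finite I\<close> \<open>I \<noteq> {}\<close> by (rule arg_min_if_finite, intro arg_min_least)
  define r where "r = v (\<rho> m)"
  have m2: "2 \<le> m" and km: "k m \<noteq> 0" using m(1) by (auto simp: I_def)
  have "\<rho> m \<noteq> 0"
  proof
    assume "\<rho> m = 0"
    thus False using \<rho>[OF m(1)] m2 km by (simp add: zero_power)
  qed
  hence r: "0 < r" by (simp add: r_def)
  have pow: "r ^ i = r ^ (i - 1) * r" if "2 \<le> i" for i
    using that by (metis Suc_diff_1 less_le_trans pos2 power_Suc2)
  have \<rho>_eq: "v (k i) * v (\<rho> i) ^ (i - 1) = 1" if "i \<in> I" for i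
  proof -
    have "v (\<rho> i) ^ (i - 1) = 1 / v (k i)" using \<rho>[OF that] by (simp flip: v_power)
    thus ?thesis using that by (simp add: I_def)
  qed
  have le: "v (k i) * r ^ i \<le> r" if "0 < i" for i
  proof -
    have "i \<in> I \<or> i = 1 \<or> 2 \<le> i \<and> k i = 0"
      using that le_degree[of "recentre b f" i] by (auto simp: I_def k_def)
    then consider "i = 1" | "i \<in> I" | "2 \<le> i" "k i = 0" by blast
    thus ?thesis
    proof cases
      case 1
      thus ?thesis using k1 r by simp
    next
      case 2
      hence "v (k i) * r ^ (i - 1) \<le> v (k i) * v (\<rho> i) ^ (i - 1)"
        using m(2) r nonneg by (intro mult_left_mono power_mono) (auto simp: r_def)
      also have "\<dots> = 1" using 2 by (rule \<rho>_eq)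
      finally show ?thesis using pow[of i] 2 r by (simp add: I_def mult.assoc[symmetric])
    next
      case 3
      thus ?thesis using r by simp
    qed
  qed
  have eq: "v (k m) * r ^ m = r"
    using \<rho>_eq[OF m(1)] pow[OF m2] by (simp add: r_def mult.assoc[symmetric])
  define x where "x = disc_seminorm v b r"
  define n where "n = type_II_degree v f x"
  have W: "weierstrass_degree v r (recentre b (f - [:poly f b:])) n"
    unfolding n_def x_def r_def using type_II_weierstrass_degree \<open>\<rho> m \<noteq> 0\<close> by blast
  have coeff: "poly.coeff (recentre b (f - [:poly f b:])) i = k i" if "0 < i" for i
    using that by (simp add: coeff_recentre_diff_const k_def)
  have "n \<noteq> 0" using weierstrass_degree_pos[OF W r] by (intro notI) simp
  have m_le: "v (k m) * r ^ m \<le> v (k n) * r ^ n"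
    using W coeff m2 \<open>n \<noteq> 0\<close> unfolding weierstrass_degree_def by (metis not_gr_zero not_numeral_le_zero)
  have top: "v (k n) * r ^ n = r" using m_le le[of n] \<open>n \<noteq> 0\<close> eq by simp
  have "m \<le> n"
  proof (rule ccontr)
    assume "\<not> m \<le> n"
    hence "v (k m) * r ^ m < v (k n) * r ^ n"
      using W coeff m2 \<open>n \<noteq> 0\<close> unfolding weierstrass_degree_def by (metis not_gr_zero not_le not_numeral_le_zero)
    with eq top show False by simp
  qed
  have "disc_seminorm v b r (f - [:poly f b:]) = r"
    using disc_seminorm_eq[OF W r] coeff[of n] top \<open>n \<noteq> 0\<close> by simp
  hence "pushforward f x = x" unfolding x_def disc_fixed_iff[OF r] using b r by simp
  moreover have "2 \<le> type_II_degree v f x" using \<open>m \<le> n\<close> m2 by (simp add: n_def)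
  ultimately have "repelling_fixed f x"
    using repelling_fixed_disc_iff[OF \<open>\<rho> m \<noteq> 0\<close>] unfolding x_def r_def by blast
  moreover have "evaluation_seminorm v b \<le> x" unfolding x_def using r by (simp add: evaluation_le_disc_iff)
  ultimately show ?thesis by blast
qed

text \<open>
  A disc that contains \<open>b\<close> may be centred at \<open>b\<close>. Then being fixed and repelling become conditions on
  the Taylor coefficients at \<open>b\<close> alone, which can be compared between discs of different radii.
\<close>

lemma repelling_disc_expansion:
  assumes b: "poly f b = b" and c: "c \<noteq> 0" and x: "x = disc_seminorm v a (v c)"
    and fixed: "pushforward f x = x" and deg: "2 \<le> type_II_degree v f x" and above: "evaluation_seminorm v b \<le> x"
  shows "x = disc_seminorm v b (v c)" "\<And>i. 0 < i \<Longrightarrow> v (poly.coeff (recentre b f) i) * v c ^ i \<le> v c"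
    "\<exists>n\<ge>2. v (poly.coeff (recentre b f) n) * v c ^ n = v c"
proof -
  have r: "0 < v c" using c by simp
  have "v (b - a) \<le> v c" using above r unfolding x by (simp add: evaluation_le_disc_iff)
  thus xb: "x = disc_seminorm v b (v c)"
    unfolding x using r by (simp add: disc_seminorm_eq_iff v_minus_commute)
  have W: "weierstrass_degree v (v c) (recentre b (f - [:poly f b:])) (type_II_degree v f x)"
    unfolding xb by (rule type_II_weierstrass_degree[OF c])
  have "disc_seminorm v b (v c) (f - [:poly f b:]) = v c"
    using fixed disc_fixed_iff[OF r] unfolding xb by blast
  with disc_seminorm_eq[OF W r]
  have top: "v (poly.coeff (recentre b (f - [:poly f b:])) (type_II_degree v f x)) *
      v c ^ type_II_degree v f x = v c" by simp
  thus "\<exists>n\<ge>2. v (poly.coeff (recentre b f) n) * v c ^ n = v c"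
    using deg coeff_recentre_diff_const[of "type_II_degree v f x" f "poly f b" b] by fastforce
  show "v (poly.coeff (recentre b f) i) * v c ^ i \<le> v c" if "0 < i" for i
    using W coeff_recentre_diff_const[OF that, of f "poly f b" b] unfolding weierstrass_degree_def top by metis
qed

text \<open>
  On a repelling fixed disc the linear coefficient is at most \<open>1\<close>, which excludes a classical repelling
  fixed point inside it; and two different radii are impossible by the growth of the nonlinear terms.
\<close>

lemma repelling_fixed_unique:
  assumes b: "poly f b = b" and x: "repelling_fixed f x" "evaluation_seminorm v b \<le> x"
    and y: "repelling_fixed f y" "evaluation_seminorm v b \<le> y"
  shows "x = y"
proof -
  have I_II: False
    if "c \<noteq> 0" "z = disc_seminorm v a (v c)" "pushforward f z = z" "2 \<le> type_II_degree v f z"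
      "evaluation_seminorm v b \<le> z" "1 < v (poly (pderiv f) b)" for z a c
    using repelling_disc_expansion(2)[OF b that(1-5), of 1] that(1,6) coeff_1_recentre[of f b] by simp
  \<comment> \<open>Terms of degree at least \<open>2\<close> grow faster than the radius, so two radii cannot both be fixed.\<close>
  have less: False
    if "c \<noteq> 0" "z = disc_seminorm v a (v c)" "pushforward f z = z" "2 \<le> type_II_degree v f z"
      "evaluation_seminorm v b \<le> z"
      "c' \<noteq> 0" "z' = disc_seminorm v a' (v c')" "pushforward f z' = z'" "2 \<le> type_II_degree v f z'"
      "evaluation_seminorm v b \<le> z'" "v c < v c'" for z a c z' a' c'
  proof -
    from repelling_disc_expansion(3)[OF b that(1-5)]
    obtain n where n: "2 \<le> n" "v (poly.coeff (recentre b f) n) * v c ^ n = v c" by blast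
    define k where "k = v (poly.coeff (recentre b f) n)"
    have pow: "t ^ n = t ^ (n - 1) * t" for t :: real
      using n(1) by (metis Suc_diff_1 less_le_trans pos2 power_Suc2)
    have "0 < v c" "0 < v c'" using that by auto
    have k1: "k * v c ^ (n - 1) = 1" using n(2) \<open>0 < v c\<close> unfolding pow k_def by simp
    hence "0 < k" using nonneg[of "poly.coeff (recentre b f) n"] by (cases "k = 0") (auto simp: k_def)
    have "v c ^ (n - 1) < v c' ^ (n - 1)"
      using that(11) n(1) nonneg by (intro power_strict_mono) auto
    hence "1 < k * v c' ^ (n - 1)" using k1 \<open>0 < k\<close> by (metis mult_strict_left_mono)
    hence "v c' < k * v c' ^ n" unfolding pow using \<open>0 < v c'\<close> by (simp flip: mult.assoc)
    moreover have "k * v c' ^ n \<le> v c'"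
      using repelling_disc_expansion(2)[OF b that(6-10), of n] n(1) by (simp add: k_def)
    ultimately show False by simp
  qed
  show ?thesis
    using x(1)
  proof (cases rule: repelling_fixed_cases)
    case (1 a)
    hence a: "a = b" using x(2) by (simp add: evaluation_le_evaluation_iff)
    show ?thesis
      using y(1)
    proof (cases rule: repelling_fixed_cases)
      case (1 a')
      thus ?thesis using y(2) \<open>x = _\<close> a by (simp add: evaluation_le_evaluation_iff)
    next
      case (2 a' c')
      thus ?thesis using I_II[OF 2 y(2)] 1(3) a by blast
    qed
  next
    case xII: (2 a c)
    show ?thesis
      using y(1)
    proof (cases rule: repelling_fixed_cases)
      case (1 a')
      hence "a' = b" using y(2) by (simp add: evaluation_le_evaluation_iff)
      thus ?thesis using I_II[OF xII x(2)] 1(3) by blast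
    next
      case yII: (2 a' c')
      have "v c = v c'"
        using less[OF xII x(2) yII y(2)] less[OF yII y(2) xII x(2)] by (metis linorder_neq_iff)
      thus ?thesis
        using repelling_disc_expansion(1)[OF b xII x(2)] repelling_disc_expansion(1)[OF b yII y(2)] by simp
    qed
  qed
qed

lemma not_repelling_Infinity: "\<not> repelling v f Infinity"
proof -
  have "poly (Polynomial.monom 1 (Polynomial.degree f) :: 'a poly) 0 = 0"
    using degree_ge_2 by (simp add: poly_monom)
  moreover have "poly (pderiv (Polynomial.monom 1 (Polynomial.degree f) :: 'a poly)) 0 = 0"
    using degree_ge_2 by (simp add: pderiv_monom poly_monom)
  ultimately show ?thesis by (simp add: multiplier_at_infinity_def Let_def)
qed

theorem sum_local_degree_repelling_fixed:
  "(\<Sum>\<xi> \<in> {\<xi> \<in> Fix v f. repelling v f \<xi>}. local_degree v f \<xi>) = Polynomial.degree f"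
proof -
  define Z where "Z = {b. poly f b = b}"
  define X where "X b = (THE x. repelling_fixed f x \<and> evaluation_seminorm v b \<le> x)" for b
  have X_iff: "repelling_fixed f x \<and> evaluation_seminorm v b \<le> x \<longleftrightarrow> x = X b" if "b \<in> Z" for b x
  proof -
    have "\<exists>!x. repelling_fixed f x \<and> evaluation_seminorm v b \<le> x"
      using repelling_fixed_above_fixed_point repelling_fixed_unique that unfolding Z_def by blast
    from theI'[OF this] this show ?thesis unfolding X_def by blast
  qed
  have roots: "set_mset (proots displacement) = Z"
    using displacement_nonzero by (auto simp: Z_def)
  hence "finite Z" by (metis finite_set_mset)
  have deg: "local_degree v f (Seminorm x) = (\<Sum>b\<in>{b \<in> Z. X b = x}. count (proots displacement) b)"
    if x: "repelling_fixed f x" for x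
  proof -
    have "local_degree v f (Seminorm x) = size {#b \<in># proots displacement. X b = x#}"
      unfolding local_degree_eq_number_of_fixed_points[OF x]
      using X_iff[of _ x] x roots by (metis (mono_tags, lifting) filter_mset_cong)
    also have "\<dots> = (\<Sum>b\<in>{b \<in> Z. X b = x}. count (proots displacement) b)"
      unfolding size_multiset_overloaded_eq using roots by (intro sum.cong) auto
    finally show ?thesis .
  qed
  have image: "{x. repelling_fixed f x} = X ` Z"
  proof
    show "X ` Z \<subseteq> {x. repelling_fixed f x}" using X_iff by blast
    show "{x. repelling_fixed f x} \<subseteq> X ` Z"
    proof
      fix x assume "x \<in> {x. repelling_fixed f x}"
      hence x: "repelling_fixed f x" by simp
      have "local_degree v f (Seminorm x) \<noteq> 0"
        using x
      proof (cases rule: repelling_fixed_cases)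
        case (1 a)
        moreover have "Polynomial.order a (f - [:poly f a:]) \<noteq> 0"
          using f_minus_const_nonzero order_root[of "f - [:poly f a:]" a] by simp
        ultimately show ?thesis by (simp add: Let_def)
      next
        case (2 a c)
        thus ?thesis using local_degree_disc[OF 2(1)] by simp
      qed
      with deg[OF x] have "{b \<in> Z. X b = x} \<noteq> {}" by (metis sum.empty)
      thus "x \<in> X ` Z" by blast
    qed
  qed
  have "{\<xi> \<in> Fix v f. repelling v f \<xi>} = Seminorm ` {x. repelling_fixed f x}"
  proof -
    have "\<xi> \<in> Seminorm ` {x. repelling_fixed f x}" if "\<xi> \<in> Fix v f" "repelling v f \<xi>" for \<xi>
      using that not_repelling_Infinity unfolding repelling_fixed_def by (cases \<xi>) blast+
    thus ?thesis unfolding repelling_fixed_def by blast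
  qed
  hence "(\<Sum>\<xi> \<in> {\<xi> \<in> Fix v f. repelling v f \<xi>}. local_degree v f \<xi>) =
      (\<Sum>x\<in>X ` Z. local_degree v f (Seminorm x))"
    unfolding image by (simp add: sum.reindex inj_on_def del: local_degree.simps)
  also have "\<dots> = (\<Sum>x\<in>X ` Z. \<Sum>b\<in>{b \<in> Z. X b = x}. count (proots displacement) b)"
    using image by (intro sum.cong refl deg) blast
  also have "\<dots> = (\<Sum>b\<in>Z. count (proots displacement) b)"
    using \<open>finite Z\<close> by (rule sum.image_gen[symmetric])
  also have "\<dots> = size (proots displacement)"
    by (simp add: size_multiset_overloaded_eq roots)
  also have "\<dots> = Polynomial.degree f"
    using splits_over_proots(2)[OF displacement_nonzero] degree_displacement by simp
  finally show ?thesis .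
qed

end

theorem proposition4p1:
  fixes v :: "'a::alg_closed_field \<Rightarrow> real"
    and f :: "'a poly"
    and d :: nat
  assumes "complete_nonarch_field v"
    and "Polynomial.degree f = d"
    and "d \<ge> 2"
  shows "(\<Sum>\<xi> \<in> {\<xi> \<in> Fix v f. repelling v f \<xi>}. local_degree v f \<xi>) = d"
proof -
  interpret polynomial_dynamics v f
    using assms by (intro polynomial_dynamics.intro polynomial_dynamics_axioms.intro) auto
  show ?thesis using sum_local_degree_repelling_fixed assms(2) by simp
qed

end
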